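(* Let $\lambda=(\lambda_1,\lambda_2,\dots)\vdash n$, let $r,r_1,r_2,\dots$ be positive integers, and let $k,k_1,k_2,\dots$ be integers or indeterminates. Then \[\Big\langle F_n^{(r,k)},\prod_{i\ge1}F_{\lambda_i}^{(r_i,k_i)}\Big\rangle=\frac{k}{rn+k}\prod_{i\ge1}\frac{k_i}{r_i\lambda_i+k_i}\binom{(rn+k)(r_i\lambda_i+k_i)+\lambda_i-1}{\lambda_i}.\]
   Context: $\langle\cdot,\cdot\rangle$ is the Hall inner product on symmetric functions, for which $\langle h_\lambda,m_\mu\rangle=\delta_{\lambda\mu}$ and $\langle p_\lambda,p_\mu\rangle=z_\lambda\delta_{\lambda\mu}$. For a positive integer $r$ and $k$ an integer or indeterminate, $F_0^{(r,k)}=1$ and for $m\ge1$ \[F_m^{(r,k)}=\frac{k}{rm+k}\sum_{\mu\vdash m}\binom{rm+k}{d_1(\mu),\dots,d_m(\mu),\,rm+k-\ell(\mu)}h_\mu=k\sum_{\mu\vdash m}\frac{(rm+k-1)(rm+k-2)\cdots(rm+k-\ell(\mu)+1)}{d_1(\mu)!\cdots d_m(\mu)!}h_\mu,\] where $d_i(\mu)$ is the number of parts of $\mu$ equal to $i$ and $\ell(\mu)$ is the number of parts; for positive integers $k$ this equals the Frobenius characteristic of the action of $\mathfrak{S}_m$ by permuting coordinates on the $(r,k)$-parking functions of length $m$ (sequences of positive integers whose increasing rearrangement $b$ satisfies $b_i\le k+(i-1)r$). Factors with $\lambda_i=0$ in the product are $1$. Binomials $\binom{x}{m}=x(x-1)\cdots(x-m+1)/m!$.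 *)

theory Defs
  imports
    Complex_Main
    "HOL-Library.Multiset"
    "HOL-Library.Poly_Mapping"
    "HOL-Computational_Algebra.Fraction_Field"
begin

section \<open>Symmetric functions in countably many variables\<close>

text \<open>
  A monomial in the variables \<open>x\<^sub>0, x\<^sub>1, \<dots>\<close> is a multiset of variable indices, with \<open>+\<close> as its
  product and \<^const>\<open>size\<close> as its degree. A symmetric function is a formal power series of
  bounded degree that is invariant under every permutation of the variables.
\<close>

typedef (overloaded) 'a symfun =
  "{f :: nat multiset \<Rightarrow> 'a::comm_ring_1.
      (\<exists>d. \<forall>M. f M \<noteq> 0 \<longrightarrow> size M \<le> d) \<and>
      (\<forall>\<pi> M. bij \<pi> \<longrightarrow> f (image_mset \<pi> M) = f M)}"
  morphisms coeff Abs_symfun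
  by (rule exI[of _ "\<lambda>_. 0"]) simp

setup_lifting type_definition_symfun

lemma finite_submultisets: "finite {A. A \<subseteq># (M :: 'a multiset)}"
proof (induction M)
  case (add x M)
  have "{A. A \<subseteq># add_mset x M} \<subseteq> {A. A \<subseteq># M} \<union> add_mset x ` {A. A \<subseteq># M}"
  proof
    fix A assume "A \<in> {A. A \<subseteq># add_mset x M}"
    then have A: "A \<subseteq># add_mset x M" by simp
    show "A \<in> {A. A \<subseteq># M} \<union> add_mset x ` {A. A \<subseteq># M}"
    proof (cases "x \<in># A")
      case True
      then obtain B where "A = add_mset x B" by (blast dest: multi_member_split)
      with A show ?thesis by auto
    next
      case False
      have "count A a \<le> count M a" for a
        using mset_subset_eq_count[OF A, of a] False by (cases "a = x") (auto simp: not_in_iff)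
      then have "A \<subseteq># M" by (simp add: subseteq_mset_def)
      then show ?thesis by simp
    qed
  qed
  then show ?case using add by (meson finite_UnI finite_imageI finite_subset)
qed simp

lemma submultisets_image:
  assumes "bij \<pi>"
  shows "bij_betw (image_mset \<pi>) {A. A \<subseteq># M} {A. A \<subseteq># image_mset \<pi> M}"
proof (rule bij_betw_byWitness[where f' = "image_mset (inv \<pi>)"])
  have 1: "inv \<pi> \<circ> \<pi> = id" and 2: "\<pi> \<circ> inv \<pi> = id"
    using assms by (auto simp: bij_is_inj bij_is_surj surj_iff[symmetric])
  show "\<forall>A\<in>{A. A \<subseteq># M}. image_mset (inv \<pi>) (image_mset \<pi> A) = A"
    by (simp add: multiset.map_comp 1)
  show "\<forall>A\<in>{A. A \<subseteq># image_mset \<pi> M}. image_mset \<pi> (image_mset (inv \<pi>) A) = A"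
    by (simp add: multiset.map_comp 2)
  show "image_mset \<pi> ` {A. A \<subseteq># M} \<subseteq> {A. A \<subseteq># image_mset \<pi> M}"
    by (auto intro: image_mset_subseteq_mono)
  have "image_mset (inv \<pi>) (image_mset \<pi> M) = M"
    by (simp add: multiset.map_comp 1)
  then show "image_mset (inv \<pi>) ` {A. A \<subseteq># image_mset \<pi> M} \<subseteq> {A. A \<subseteq># M}"
    using image_mset_subseteq_mono[of _ "image_mset \<pi> M" "inv \<pi>"] by auto
qed

instantiation symfun :: (comm_ring_1) comm_ring_1
begin

lift_definition zero_symfun :: "'a symfun" is "\<lambda>_. 0" by simp

lift_definition one_symfun :: "'a symfun" is "\<lambda>M. if M = {#} then 1 else 0" by auto

lift_definition plus_symfun :: "'a symfun \<Rightarrow> 'a symfun \<Rightarrow> 'a symfun"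
  is "\<lambda>f g M. f M + g M"
proof (elim conjE exE, intro conjI)
  fix f g :: "nat multiset \<Rightarrow> 'a" and d e
  assume "\<forall>M. f M \<noteq> 0 \<longrightarrow> size M \<le> d" "\<forall>M. g M \<noteq> 0 \<longrightarrow> size M \<le> e"
  then show "\<exists>d. \<forall>M. f M + g M \<noteq> 0 \<longrightarrow> size M \<le> d"
    by (intro exI[of _ "max d e"]) (force simp: le_max_iff_disj)
qed auto

lift_definition uminus_symfun :: "'a symfun \<Rightarrow> 'a symfun" is "\<lambda>f M. - f M" by simp

lift_definition minus_symfun :: "'a symfun \<Rightarrow> 'a symfun \<Rightarrow> 'a symfun"
  is "\<lambda>f g M. f M - g M"
proof (elim conjE exE, intro conjI)
  fix f g :: "nat multiset \<Rightarrow> 'a" and d e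
  assume "\<forall>M. f M \<noteq> 0 \<longrightarrow> size M \<le> d" "\<forall>M. g M \<noteq> 0 \<longrightarrow> size M \<le> e"
  then show "\<exists>d. \<forall>M. f M - g M \<noteq> 0 \<longrightarrow> size M \<le> d"
    by (intro exI[of _ "max d e"]) (force simp: le_max_iff_disj)
qed auto

lift_definition times_symfun :: "'a symfun \<Rightarrow> 'a symfun \<Rightarrow> 'a symfun"
  is "\<lambda>f g M. \<Sum>A | A \<subseteq># M. f A * g (M - A)"
proof (elim conjE exE, intro conjI allI impI)
  fix f g :: "nat multiset \<Rightarrow> 'a" and d e
  assume fd: "\<forall>M. f M \<noteq> 0 \<longrightarrow> size M \<le> d" and ge: "\<forall>M. g M \<noteq> 0 \<longrightarrow> size M \<le> e"
  show "\<exists>d. \<forall>M. (\<Sum>A | A \<subseteq># M. f A * g (M - A)) \<noteq> 0 \<longrightarrow> size M \<le> d"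
  proof (intro exI[of _ "d + e"] allI impI)
    fix M assume "(\<Sum>A | A \<subseteq># M. f A * g (M - A)) \<noteq> 0"
    then obtain A where A: "A \<subseteq># M" "f A * g (M - A) \<noteq> 0"
      by (auto elim: sum.not_neutral_contains_not_neutral)
    from A(2) have "f A \<noteq> 0" "g (M - A) \<noteq> 0" by auto
    then have "size A + size (M - A) \<le> d + e" using fd ge by (intro add_mono) auto
    then show "size M \<le> d + e" using A(1) by (metis size_union subset_mset.add_diff_inverse)
  qed
next
  fix f g :: "nat multiset \<Rightarrow> 'a" and \<pi> :: "nat \<Rightarrow> nat" and M
  assume fs: "\<forall>\<pi> M. bij \<pi> \<longrightarrow> f (image_mset \<pi> M) = f M"
    and gs: "\<forall>\<pi> M. bij \<pi> \<longrightarrow> g (image_mset \<pi> M) = g M" and p: "bij \<pi>"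
  have "(\<Sum>A | A \<subseteq># image_mset \<pi> M. f A * g (image_mset \<pi> M - A)) =
        (\<Sum>A | A \<subseteq># M. f (image_mset \<pi> A) * g (image_mset \<pi> M - image_mset \<pi> A))"
    by (rule sum.reindex_bij_betw[OF submultisets_image[OF p], symmetric])
  also have "\<dots> = (\<Sum>A | A \<subseteq># M. f A * g (M - A))"
  proof (rule sum.cong[OF refl])
    fix A assume "A \<in> {A. A \<subseteq># M}"
    then have "image_mset \<pi> M - image_mset \<pi> A = image_mset \<pi> (M - A)"
      by (simp add: image_mset_Diff)
    then show "f (image_mset \<pi> A) * g (image_mset \<pi> M - image_mset \<pi> A) = f A * g (M - A)"
      using fs gs p by simp
  qed
  finally show "(\<Sum>A | A \<subseteq># image_mset \<pi> M. f A * g (image_mset \<pi> M - A)) =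
        (\<Sum>A | A \<subseteq># M. f A * g (M - A))" .
qed

instance
proof
  fix f g h :: "'a symfun"
  show "f * g * h = f * (g * h)"
  proof (transfer, rule ext)
    fix f g h :: "nat multiset \<Rightarrow> 'a" and M
    have "(\<Sum>A | A \<subseteq># M. (\<Sum>B | B \<subseteq># A. f B * g (A - B)) * h (M - A)) =
          (\<Sum>(A, B) \<in> Sigma {A. A \<subseteq># M} (\<lambda>A. {B. B \<subseteq># A}). f B * g (A - B) * h (M - A))"
      by (simp add: sum_distrib_right sum.Sigma finite_submultisets)
    also have "\<dots> = (\<Sum>(B, C) \<in> Sigma {B. B \<subseteq># M} (\<lambda>B. {C. C \<subseteq># M - B}).
        f B * (g C * h (M - B - C)))"
    proof (rule sum.reindex_bij_witness[where i = "\<lambda>(B, C). (B + C, B)" and j = "\<lambda>(A, B). (B, A - B)"])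
      have 1: "B + (A - B) = A" "A - B \<subseteq># M - B" "B \<subseteq># M" "M - B - (A - B) = M - A"
        if "A \<subseteq># M" "B \<subseteq># A" for A B
        using that unfolding subseteq_mset_def multiset_eq_iff
        by (auto simp: diff_le_mono intro: order_trans)
      have 2: "B + C \<subseteq># M" if "B \<subseteq># M" "C \<subseteq># M - B" for B C
        using that by (simp add: subset_mset.le_diff_conv2 add.commute)
      show "\<And>a. a \<in> (SIGMA A:{A. A \<subseteq># M}. {B. B \<subseteq># A}) \<Longrightarrow>
          (case case a of (A, B) \<Rightarrow> (B, A - B) of (B, C) \<Rightarrow> (B + C, B)) = a"
        using 1 by clarsimp
      show "\<And>a. a \<in> (SIGMA A:{A. A \<subseteq># M}. {B. B \<subseteq># A}) \<Longrightarrow>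
          (case a of (A, B) \<Rightarrow> (B, A - B)) \<in> (SIGMA B:{B. B \<subseteq># M}. {C. C \<subseteq># M - B})"
        using 1 by clarsimp
      show "\<And>b. b \<in> (SIGMA B:{B. B \<subseteq># M}. {C. C \<subseteq># M - B}) \<Longrightarrow>
          (case case b of (B, C) \<Rightarrow> (B + C, B) of (A, B) \<Rightarrow> (B, A - B)) = b"
        by clarsimp
      show "\<And>b. b \<in> (SIGMA B:{B. B \<subseteq># M}. {C. C \<subseteq># M - B}) \<Longrightarrow>
          (case b of (B, C) \<Rightarrow> (B + C, B)) \<in> (SIGMA A:{A. A \<subseteq># M}. {B. B \<subseteq># A})"
        using 2 by clarsimp
      show "\<And>a. a \<in> (SIGMA A:{A. A \<subseteq># M}. {B. B \<subseteq># A}) \<Longrightarrow>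
          (case case a of (A, B) \<Rightarrow> (B, A - B) of (B, C) \<Rightarrow> f B * (g C * h (M - B - C))) =
          (case a of (A, B) \<Rightarrow> f B * g (A - B) * h (M - A))"
        using 1(4) by (clarsimp simp del: diff_diff_add_mset simp: mult.assoc)
    qed
    also have "\<dots> = (\<Sum>A | A \<subseteq># M. f A * (\<Sum>B | B \<subseteq># M - A. g B * h (M - A - B)))"
      by (simp add: sum_distrib_left sum.Sigma finite_submultisets)
    finally show "(\<Sum>A | A \<subseteq># M. (\<Sum>B | B \<subseteq># A. f B * g (A - B)) * h (M - A)) =
        (\<Sum>A | A \<subseteq># M. f A * (\<Sum>B | B \<subseteq># M - A. g B * h (M - A - B)))" .
  qed
  show "f * g = g * f"
  proof (transfer, rule ext)
    fix f g :: "nat multiset \<Rightarrow> 'a" and M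
    show "(\<Sum>A | A \<subseteq># M. f A * g (M - A)) = (\<Sum>A | A \<subseteq># M. g A * f (M - A))"
      by (rule sum.reindex_bij_witness[where i = "\<lambda>A. M - A" and j = "\<lambda>A. M - A"])
        (auto simp: mult.commute subset_mset.diff_diff_right)
  qed
  show "1 * f = f"
  proof (transfer, rule ext)
    fix f :: "nat multiset \<Rightarrow> 'a" and M
    have "(\<Sum>A | A \<subseteq># M. (if A = {#} then 1 else 0) * f (M - A)) =
          (\<Sum>A\<in>{{#}}. (if A = {#} then 1 else 0) * f (M - A))"
      by (rule sum.mono_neutral_right) (auto simp: finite_submultisets)
    then show "(\<Sum>A | A \<subseteq># M. (if A = {#} then 1 else 0) * f (M - A)) = f M" by simp
  qed
  show "(f + g) * h = f * h + g * h"
    by transfer (simp add: distrib_right sum.distrib)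
  show "f + g + h = f + (g + h)" by transfer (simp add: add.assoc)
  show "f + g = g + f" by transfer (simp add: add.commute)
  show "0 + f = f" by transfer simp
  show "- f + f = 0" by transfer simp
  show "f - g = f + - g" by transfer simp
  show "(0 :: 'a symfun) \<noteq> 1" by transfer (metis zero_neq_one)
qed

end

lift_definition smult :: "'a::comm_ring_1 \<Rightarrow> 'a symfun \<Rightarrow> 'a symfun"
  is "\<lambda>c f M. c * f M"
proof (elim conjE exE, intro conjI)
  fix c :: 'a and f :: "nat multiset \<Rightarrow> 'a" and d
  assume "\<forall>M. f M \<noteq> 0 \<longrightarrow> size M \<le> d"
  then show "\<exists>d. \<forall>M. c * f M \<noteq> 0 \<longrightarrow> size M \<le> d"
    by (intro exI[of _ d] allI impI) (metis mult_zero_right)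
qed auto

interpretation symfun: vector_space "smult :: 'a::field \<Rightarrow> 'a symfun \<Rightarrow> 'a symfun"
  by unfold_locales (transfer; simp add: algebra_simps fun_eq_iff)+


section \<open>Partitions and the classical bases\<close>

definition partition_of :: "nat list \<Rightarrow> nat \<Rightarrow> bool" (infix "\<turnstile>" 50) where
  "\<mu> \<turnstile> n \<longleftrightarrow> sorted_wrt (\<ge>) \<mu> \<and> 0 \<notin> set \<mu> \<and> sum_list \<mu> = n"

lift_definition h_sym :: "nat \<Rightarrow> 'a::comm_ring_1 symfun"
  is "\<lambda>n M. if size M = n then 1 else 0"
  by auto

definition h_part :: "nat list \<Rightarrow> 'a::comm_ring_1 symfun" where
  "h_part \<mu> = prod_list (map h_sym \<mu>)"

definition exponents :: "nat multiset \<Rightarrow> nat multiset" where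
  "exponents M = image_mset (count M) (mset_set (set_mset M))"

lemma exponents_image:
  assumes "bij \<pi>"
  shows "exponents (image_mset \<pi> M) = exponents M"
proof -
  have inj: "inj \<pi>" using assms by (rule bij_is_inj)
  have c: "count (image_mset \<pi> M) (\<pi> x) = count M x" for x
  proof -
    have "\<pi> -` {\<pi> x} = {x}" using inj by (auto dest: injD)
    then show ?thesis by (cases "x \<in># M") (auto simp: count_image_mset not_in_iff)
  qed
  have "mset_set (\<pi> ` set_mset M) = image_mset \<pi> (mset_set (set_mset M))"
    using inj by (simp add: image_mset_mset_set inj_on_subset)
  then show ?thesis
    by (simp add: exponents_def multiset.map_comp comp_def c)
qed

lemma size_exponents: "sum_mset (exponents M) = size M"
  by (simp add: exponents_def size_multiset_overloaded_eq sum_unfold_sum_mset)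

lift_definition m_part :: "nat list \<Rightarrow> 'a::comm_ring_1 symfun"
  is "\<lambda>\<mu> M. if exponents M = mset \<mu> then 1 else 0"
proof (intro conjI allI impI)
  fix \<mu> :: "nat list"
  show "\<exists>d. \<forall>M. (if exponents M = mset \<mu> then 1 else (0::'a)) \<noteq> 0 \<longrightarrow> size M \<le> d"
    by (intro exI[of _ "sum_list \<mu>"])
      (metis order_refl size_exponents sum_mset_sum_list)
qed (simp add: exponents_image)


section \<open>The Hall inner product\<close>

definition is_hall_form :: "('a::field symfun \<Rightarrow> 'a symfun \<Rightarrow> 'a) \<Rightarrow> bool" where
  "is_hall_form B \<longleftrightarrow>
     (\<forall>g. Vector_Spaces.linear smult (*) (\<lambda>f. B f g)) \<and>
     (\<forall>f. Vector_Spaces.linear smult (*) (\<lambda>g. B f g)) \<and>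
     (\<forall>\<nu> \<mu> a b. \<nu> \<turnstile> a \<longrightarrow> \<mu> \<turnstile> b \<longrightarrow> B (h_part \<nu>) (m_part \<mu>) = (if \<nu> = \<mu> then 1 else 0))"

text \<open>There is exactly one such form, because the \<open>h\<^sub>\<lambda>\<close> and the \<open>m\<^sub>\<mu>\<close> are bases.\<close>

definition hall :: "'a::field symfun \<Rightarrow> 'a symfun \<Rightarrow> 'a" where
  "hall = (THE B. is_hall_form B)"


section \<open>The parking function symmetric functions\<close>

text \<open>
  The definition is division-free in \<open>k\<close>, so that it covers the values with \<open>r * m + k = 0\<close>;
  lemma \<open>F_park_multinomial\<close> below is the form with the prefactor \<open>k / (r * m + k)\<close>, in which the
  multinomial coefficient with last entry \<open>r * m + k - length \<mu>\<close> is a falling factorial of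
  length \<open>length \<mu>\<close> divided by the factorials of the part multiplicities.
\<close>

definition F_park :: "nat \<Rightarrow> 'a::field_char_0 \<Rightarrow> nat \<Rightarrow> 'a symfun" where
  "F_park r k m = (if m = 0 then 1 else
     smult k (\<Sum>\<mu> | \<mu> \<turnstile> m.
       smult ((\<Prod>j = 1..<length \<mu>. of_nat (r * m) + k - of_nat j) /
              (\<Prod>i = 1..m. fact (count_list \<mu> i)))
         (h_part \<mu>)))"

lemma F_park_multinomial:
  assumes "m > 0" "of_nat (r * m) + k \<noteq> (0 :: 'a::field_char_0)"
  shows "F_park r k m = smult (k / (of_nat (r * m) + k)) (\<Sum>\<mu> | \<mu> \<turnstile> m.
       smult ((\<Prod>j = 0..<length \<mu>. of_nat (r * m) + k - of_nat j) /
              (\<Prod>i = 1..m. fact (count_list \<mu> i)))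
         (h_part \<mu>))"
proof -
  define x where "x = of_nat (r * m) + k"
  have x: "x \<noteq> 0" using assms(2) by (simp add: x_def)
  have "(\<Prod>j = 0..<length \<mu>. x - of_nat j) = x * (\<Prod>j = 1..<length \<mu>. x - of_nat j)"
    if "\<mu> \<turnstile> m" for \<mu>
  proof -
    have "length \<mu> > 0" using that assms(1) by (auto simp: partition_of_def)
    then show ?thesis by (simp add: prod.atLeast_Suc_lessThan)
  qed
  then have "(\<Sum>\<mu> | \<mu> \<turnstile> m. smult ((\<Prod>j = 0..<length \<mu>. x - of_nat j) /
              (\<Prod>i = 1..m. fact (count_list \<mu> i))) (h_part \<mu>)) =
        smult x (\<Sum>\<mu> | \<mu> \<turnstile> m. smult ((\<Prod>j = 1..<length \<mu>. x - of_nat j) /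
              (\<Prod>i = 1..m. fact (count_list \<mu> i))) (h_part \<mu>))"
    unfolding symfun.scale_sum_right by (intro sum.cong) auto
  then show ?thesis
    using x assms(1) unfolding F_park_def x_def[symmetric] by simp
qed


section \<open>Integers and indeterminates\<close>

instance fract :: ("{idom, ring_char_0}") field_char_0
proof
  show "inj (of_nat :: nat \<Rightarrow> 'a fract)"
    by (rule injI) (simp add: of_nat_fract eq_fract)
qed

text \<open>The field of rational functions over the rationals in indeterminates \<open>t\<^sub>0, t\<^sub>1, \<dots>\<close>.\<close>

type_synonym ratfun = "((nat \<Rightarrow>\<^sub>0 nat) \<Rightarrow>\<^sub>0 rat) fract"

definition indet :: "nat \<Rightarrow> ratfun" where
  "indet j = Fract (Poly_Mapping.single (Poly_Mapping.single j 1) 1) 1"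

definition int_or_indet :: "ratfun \<Rightarrow> bool" where
  "int_or_indet k \<longleftrightarrow> k \<in> \<int> \<or> k \<in> range indet"

end

theory Submission
  imports
    "HOL-Computational_Algebra.Polynomial"
    "HOL-Computational_Algebra.Formal_Power_Series"
    "HOL-Combinatorics.Permutations"
    Defs
begin

text \<open>
  Put \<open>x = r n + k\<close>. Since \<open>h\<^sub>\<mu>\<close> and \<open>m\<^sub>\<mu>\<close> are dual, \<open>\<langle>F\<^sub>n, g\<rangle>\<close> is \<open>k\<close> times the sum over \<open>\<mu> \<turnstile> n\<close> of
  \<open>(x - 1) \<dots> (x - l(\<mu>) + 1) / \<Prod>d\<^sub>i(\<mu>)!\<close> times the coefficient of \<open>m\<^sub>\<mu>\<close> in \<open>g\<close>. For a positive integer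
  \<open>x = N\<close> this is \<open>k / N\<close> times the specialisation of \<open>g\<close> at \<open>N\<close> ones, because \<open>m\<^sub>\<mu>\<close> specialises to
  \<open>N (N - 1) \<dots> (N - l(\<mu>) + 1) / \<Prod>d\<^sub>i(\<mu>)!\<close>. The specialisation is multiplicative, and its value on each
  factor of \<open>g\<close> is obtained in the same way, with the specialisations of the \<open>h\<^sub>\<mu>\<close> in the role of the
  coefficients of \<open>g\<close> and Vandermonde's identity for negative binomials. Both sides of the
  claim are polynomials in \<open>x\<close>, so agreement at all positive integers suffices.

  The Hall form exists because the \<open>h\<^sub>\<mu>\<close> are a basis. They span: \<open>p\<^sub>k m\<^sub>\<kappa>\<close> is a nonzero multiple of
  \<open>m\<close> indexed by \<open>\<kappa>\<close> with the part \<open>k\<close> added, up to terms with fewer parts, and Newton's identities express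
  \<open>p\<^sub>k\<close> in terms of the \<open>h\<^sub>i\<close>. Counting partitions of size at most \<open>d\<close> then gives independence.
\<close>

section \<open>Exponents and partitions\<close>

lemma exponents_empty [simp]: "exponents {#} = {#}"
  by (simp add: exponents_def)

lemma exponents_replicate_add:
  assumes "x \<notin># M" "p > 0"
  shows "exponents (replicate_mset p x + M) = add_mset p (exponents M)"
proof -
  have "set_mset (replicate_mset p x + M) = insert x (set_mset M)"
    using assms by auto
  moreover have "image_mset (count (replicate_mset p x + M)) (mset_set (set_mset M)) =
      image_mset (count M) (mset_set (set_mset M))"
    using assms by (intro image_mset_cong) auto
  ultimately show ?thesis
    using assms by (simp add: exponents_def count_eq_zero_iff)
qed

lemma zero_notin_exponents [simp]: "0 \<notin># exponents M"
  by (auto simp: exponents_def count_eq_zero_iff)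

lemma finite_partitions [simp]: "finite {\<mu>. \<mu> \<turnstile> n}"
proof (rule finite_subset)
  have "length \<mu> \<le> sum_list \<mu>" if "0 \<notin> set \<mu>" for \<mu> :: "nat list"
    using that by (induction \<mu>) auto
  then show "{\<mu>. \<mu> \<turnstile> n} \<subseteq> {\<mu>. set \<mu> \<subseteq> {..n} \<and> length \<mu> \<le> n}"
    by (auto simp: partition_of_def dest: member_le_sum_list)
  show "finite {\<mu>. set \<mu> \<subseteq> {..n} \<and> length \<mu> \<le> n}"
    by (rule finite_lists_length_le) simp
qed

text \<open>Partitions are decreasing lists, whereas exponents form multisets. This lemma and the
  next one pass between the two descriptions.\<close>

lemma partition_unique_list:
  assumes "\<mu> \<turnstile> a" "\<nu> \<turnstile> b" "mset \<mu> = mset \<nu>"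
  shows "\<mu> = \<nu>"
proof -
  have "sorted (rev \<mu>)" "sorted (rev \<nu>)"
    using assms by (simp_all add: partition_of_def sorted_wrt_rev)
  with assms(3) have "rev \<mu> = rev \<nu>"
    by (metis mset_rev properties_for_sort)
  then show ?thesis by simp
qed

lemma ex_partition_mset:
  assumes "0 \<notin># \<nu>"
  obtains \<mu> where "\<mu> \<turnstile> sum_mset \<nu>" "mset \<mu> = \<nu>"
proof
  let ?\<mu> = "rev (sorted_list_of_multiset \<nu>)"
  show "mset ?\<mu> = \<nu>" by simp
  then have "sum_list ?\<mu> = sum_mset \<nu>" "set ?\<mu> = set_mset \<nu>"
    by (metis sum_mset_sum_list, metis set_mset_mset)
  then show "?\<mu> \<turnstile> sum_mset \<nu>"
    using assms by (simp add: partition_of_def sorted_wrt_rev)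
qed

section \<open>Monomials in finitely many variables\<close>

text \<open>These are the monomials of degree \<open>m\<close> in the first \<open>Y\<close>
  variables. Summing coefficients over them amounts to setting those variables to 1 and all others
  to 0.\<close>

definition msets :: "nat \<Rightarrow> nat \<Rightarrow> nat multiset set" where
  "msets Y m = {M. set_mset M \<subseteq> {..<Y} \<and> size M = m}"

lemma msets_0: "msets 0 m = (if m = 0 then {{#}} else {})"
  by (auto simp: msets_def)

text \<open>Splitting off the power \<open>p\<close> of the last variable \<open>Y\<close> is what
  makes induction on the number of variables possible.\<close>

lemma bij_betw_msets_Suc:
  "bij_betw (\<lambda>(p, M). replicate_mset p Y + M) (SIGMA p:{..m}. msets Y (m - p)) (msets (Suc Y) m)"
proof (rule bij_betw_byWitness
    [where f' = "\<lambda>M. (count M Y, filter_mset (\<lambda>x. x \<noteq> Y) M)"])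
  have "count M Y = 0" "filter_mset (\<lambda>x. x \<noteq> Y) M = M" if "set_mset M \<subseteq> {..<Y}" for M
    using that by (auto simp: count_eq_zero_iff filter_mset_eq_conv)
  then show "\<forall>a\<in>SIGMA p:{..m}. msets Y (m - p).
      (\<lambda>M. (count M Y, filter_mset (\<lambda>x. x \<noteq> Y) M)) ((\<lambda>(p, M). replicate_mset p Y + M) a) = a"
    by (auto simp: msets_def)
  have eq: "replicate_mset (count M Y) Y + filter_mset (\<lambda>x. x \<noteq> Y) M = M" for M
    by (rule multiset_eqI) simp
  then show "\<forall>M\<in>msets (Suc Y) m.
      (\<lambda>(p, M). replicate_mset p Y + M) (count M Y, filter_mset (\<lambda>x. x \<noteq> Y) M) = M"
    by simp
  show "(\<lambda>(p, M). replicate_mset p Y + M) ` (SIGMA p:{..m}. msets Y (m - p)) \<subseteq> msets (Suc Y) m"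
    by (auto simp: msets_def less_Suc_eq split: if_splits)
  have "size (filter_mset (\<lambda>x. x \<noteq> Y) M) = size M - count M Y" for M
    using arg_cong[OF eq[of M], of size] by simp
  then show "(\<lambda>M. (count M Y, filter_mset (\<lambda>x. x \<noteq> Y) M)) ` msets (Suc Y) m
      \<subseteq> (SIGMA p:{..m}. msets Y (m - p))"
    by (auto simp: msets_def less_Suc_eq count_le_size)
qed

lemma finite_msets [simp]: "finite (msets Y m)"
proof (induction Y arbitrary: m)
  case 0
  then show ?case by (simp add: msets_0)
next
  case (Suc Y)
  then show ?case
    using bij_betw_finite[OF bij_betw_msets_Suc[of Y m]] by simp
qed

lemma sum_msets_Suc:
  "(\<Sum>M\<in>msets (Suc Y) m. f M) = (\<Sum>p\<le>m. \<Sum>M\<in>msets Y (m - p). f (replicate_mset p Y + M))"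
  using sum.reindex_bij_betw[OF bij_betw_msets_Suc[of Y m], of f]
  by (simp add: sum.Sigma case_prod_unfold)

text \<open>The weight of \<open>p\<close> is the coefficient of t^p in (1 - t)^a, so the sum is the
  coefficient of t^m in the product of \<open>Y\<close> copies of this series, that is, in (1 -
  t)^(a Y). Exponent 0 has weight 1, so variables that do not occur may be ignored.\<close>

lemma sum_msets_prod_exponents:
  fixes a :: "'a::field_char_0"
  shows "(\<Sum>M\<in>msets Y m. \<Prod>p\<in>#exponents M. (- 1) ^ p * (a gchoose p)) =
         (- 1) ^ m * ((a * of_nat Y) gchoose m)"
proof (induction Y arbitrary: m)
  case 0
  then show ?case by (simp add: msets_0 gbinomial_0_left)
next
  case (Suc Y)
  define c where "c p = (- 1) ^ p * (a gchoose p)" for p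
  have step: "(\<Prod>q\<in>#exponents (replicate_mset p Y + M). c q) =
      c p * (\<Prod>q\<in>#exponents M. c q)" if "M \<in> msets Y l" for p M l
  proof (cases "p = 0")
    case False
    have "Y \<notin># M" using that by (auto simp: msets_def)
    with False show ?thesis by (simp add: exponents_replicate_add)
  qed (simp add: c_def)
  have "(\<Sum>M\<in>msets (Suc Y) m. \<Prod>p\<in>#exponents M. c p) =
      (\<Sum>p\<le>m. c p * ((- 1) ^ (m - p) * ((a * of_nat Y) gchoose (m - p))))"
    unfolding sum_msets_Suc
    using Suc by (simp add: step sum_distrib_left[symmetric] flip: c_def cong: sum.cong)
  also have "\<dots> = (\<Sum>p\<le>m. (- 1) ^ m * ((a gchoose p) * ((a * of_nat Y) gchoose (m - p))))"
    by (intro sum.cong) (auto simp: c_def power_add[symmetric] mult_ac)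
  also have "\<dots> = (- 1) ^ m * ((a + a * of_nat Y) gchoose m)"
    by (simp add: sum_distrib_left[symmetric] gbinomial_Vandermonde atLeast0AtMost[symmetric])
  finally show ?case by (simp add: c_def algebra_simps)
qed

lemma minus_one_gbinomial: "(- 1 :: 'a::field_char_0) gchoose p = (- 1) ^ p"
  by (simp add: gbinomial_pochhammer flip: pochhammer_fact)

text \<open>For a = -1 every weight in the preceding sum equals 1.\<close>

lemma card_msets:
  "of_nat (card (msets Y m)) = (- 1) ^ m * ((- of_nat Y :: 'a::field_char_0) gchoose m)"
  using sum_msets_prod_exponents[where Y = Y and a = "- 1 :: 'a" and m = m]
  by (simp add: minus_one_gbinomial power_mult_distrib[symmetric])

section \<open>Counting monomials with prescribed exponents\<close>

lemma prod_fact_count_add_mset: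
  "(\<Prod>q\<in>set_mset (add_mset p \<nu>). fact (count (add_mset p \<nu>) q) :: nat) =
    Suc (count \<nu> p) * (\<Prod>q\<in>set_mset \<nu>. fact (count \<nu> q))"
proof -
  have "(\<Prod>q\<in>set_mset \<nu>. fact (count \<nu> q) :: nat) =
      (\<Prod>q\<in>insert p (set_mset \<nu>). fact (count \<nu> q))"
    by (rule prod.mono_neutral_left) (auto simp: not_in_iff)
  also have "\<dots> = fact (count \<nu> p) * (\<Prod>q\<in>set_mset \<nu> - {p}. fact (count \<nu> q))"
    by (simp add: prod.insert_remove)
  finally have "(\<Prod>q\<in>set_mset \<nu>. fact (count \<nu> q) :: nat) = \<dots>" .
  moreover have "(\<Prod>q\<in>set_mset \<nu> - {p}. fact (count (add_mset p \<nu>) q) :: nat) =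
      (\<Prod>q\<in>set_mset \<nu> - {p}. fact (count \<nu> q))"
    by (intro prod.cong) auto
  ultimately show ?thesis
    by (simp add: prod.insert_remove del: count_add_mset) (simp add: algebra_simps)
qed

text \<open>Both sides count the ways to place \<open>size \<nu>\<close> labelled parts on distinct
  variables among \<open>Y\<close>: each monomial with exponents \<nu> comes from as many labellings
  as the product of factorials says. The induction looks at the exponent of the last variable and
  ends with Pascal's rule.\<close>

lemma card_msets_exponents:
  assumes "0 \<notin># \<nu>"
  shows "(\<Sum>M\<in>msets Y (sum_mset \<nu>). of_bool (exponents M = \<nu>)) *
           (\<Prod>p\<in>set_mset \<nu>. fact (count \<nu> p)) = fact (size \<nu>) * (Y choose size \<nu>)"
  using assms
proof (induction Y arbitrary: \<nu>)
  case 0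
  have "sum_mset \<nu> \<noteq> 0" if "\<nu> \<noteq> {#}"
    using 0 that by (metis multiset_nonemptyE sum_mset_0_iff)
  then show ?case by (cases "\<nu> = {#}") (auto simp: msets_0 nonempty_has_size)
next
  case (Suc Y)
  define N where "N \<nu> = (\<Sum>M\<in>msets Y (sum_mset \<nu>). of_bool (exponents M = \<nu>) :: nat)" for \<nu>
  define D where "D \<nu> = (\<Prod>p\<in>set_mset \<nu>. fact (count \<nu> p) :: nat)" for \<nu> :: "nat multiset"
  have D_diff: "D \<nu> = count \<nu> p * D (\<nu> - {#p#})" if p: "p \<in># \<nu>" for p \<nu>
  proof -
    obtain \<nu>' where "\<nu> = add_mset p \<nu>'" using multi_member_split[OF p] by auto
    moreover have "D (add_mset p \<nu>') = Suc (count \<nu>' p) * D \<nu>'"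
      unfolding D_def by (rule prod_fact_count_add_mset)
    ultimately show ?thesis by simp
  qed
  have IH: "N \<nu> * D \<nu> = fact (size \<nu>) * (Y choose size \<nu>)" if "0 \<notin># \<nu>" for \<nu>
    using Suc.IH[OF that] by (simp add: N_def D_def)
  define s where "s = sum_mset \<nu>"
  have Yn: "Y \<notin># M" if "M \<in> msets Y l" for M l
    using that by (auto simp: msets_def)
  \<comment> \<open>A nonzero exponent \<open>p\<close> of the last variable must be a part of
    \<nu>, and the other variables then carry the remaining parts.\<close>
  have inner: "(\<Sum>M\<in>msets Y (s - p). of_bool (exponents (replicate_mset p Y + M) = \<nu>)) =
      (if p = 0 then N \<nu> else if p \<in># \<nu> then N (\<nu> - {#p#}) else 0)" for p
  proof -
    consider "p = 0" | "p > 0" "p \<in># \<nu>" | "p > 0" "p \<notin># \<nu>" by auto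
    then show ?thesis
    proof cases
      case 2
      then obtain \<nu>' where \<nu>: "\<nu> = add_mset p \<nu>'" by (blast dest: multi_member_split)
      then show ?thesis
        using 2 by (auto simp: N_def s_def exponents_replicate_add Yn intro!: sum.cong)
    next
      case 3
      then have "add_mset p (exponents M) \<noteq> \<nu>" for M by auto
      with 3 show ?thesis by (auto simp: exponents_replicate_add Yn)
    qed (simp add: N_def s_def)
  qed
  have pos: "p > 0" if "p \<in># \<nu>" for p using Suc.prems that by (cases p) auto
  have "(\<Sum>M\<in>msets (Suc Y) s. of_bool (exponents M = \<nu>)) =
      (\<Sum>p\<le>s. if p = 0 then N \<nu> else if p \<in># \<nu> then N (\<nu> - {#p#}) else 0)"
    by (simp add: sum_msets_Suc inner)
  also have "\<dots> = (\<Sum>p\<in>insert 0 (set_mset \<nu>).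
      if p = 0 then N \<nu> else if p \<in># \<nu> then N (\<nu> - {#p#}) else 0)"
    by (rule sum.mono_neutral_right) (auto simp: s_def dest: multi_member_split)
  also have "\<dots> = N \<nu> + (\<Sum>p\<in>set_mset \<nu>. N (\<nu> - {#p#}))"
    using Suc.prems by (auto intro!: sum.cong dest: pos)
  \<comment> \<open>Removing one part \<open>p\<close> divides \<open>D \<nu>\<close> by the
    multiplicity of \<open>p\<close>; these multiplicities later add up to
    \<open>size \<nu>\<close>.\<close>
  finally have "(\<Sum>M\<in>msets (Suc Y) s. of_bool (exponents M = \<nu>)) * D \<nu> =
      N \<nu> * D \<nu> + (\<Sum>p\<in>set_mset \<nu>. count \<nu> p * (N (\<nu> - {#p#}) * D (\<nu> - {#p#})))"
    by (auto simp: distrib_right sum_distrib_right D_diff[of _ \<nu>] simp del: sum_of_bool_eq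
        intro!: sum.cong)
  also have "\<dots> = fact (size \<nu>) * (Y choose size \<nu>) +
      (\<Sum>p\<in>set_mset \<nu>. count \<nu> p * (fact (size \<nu> - 1) * (Y choose (size \<nu> - 1))))"
  proof -
    have "0 \<notin># \<nu> - {#p#}" for p using Suc.prems by (meson in_diffD)
    then show ?thesis
      using Suc.prems by (auto simp: IH size_Diff_singleton intro!: sum.cong)
  qed
  also have "\<dots> = fact (size \<nu>) * (Y choose size \<nu>) +
      size \<nu> * (fact (size \<nu> - 1) * (Y choose (size \<nu> - 1)))"
    by (simp add: sum_distrib_right[symmetric] size_multiset_overloaded_eq)
  also have "\<dots> = fact (size \<nu>) * (Suc Y choose size \<nu>)"
    by (cases "size \<nu>") (simp_all add: algebra_simps)
  finally show ?case by (simp add: D_def s_def)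
qed

text \<open>Group the monomials by their exponents: the quotient on the left is the number of
  monomials of type \<mu>, which is the value of \<open>m_part \<mu>\<close> at \<open>Y\<close>
  ones.\<close>

lemma sum_partitions_eq_sum_msets:
  fixes c :: "nat multiset \<Rightarrow> 'a::field_char_0"
  shows "(\<Sum>\<mu> | \<mu> \<turnstile> n. (\<Prod>j = 0..<length \<mu>. of_nat Y - of_nat j) /
             (\<Prod>i = 1..n. fact (count_list \<mu> i)) * c (mset \<mu>)) =
         (\<Sum>M\<in>msets Y n. c (exponents M))"
proof -
  have coef: "(\<Prod>j = 0..<length \<mu>. of_nat Y - of_nat j) / (\<Prod>i = 1..n. fact (count_list \<mu> i)) =
      (\<Sum>M\<in>msets Y n. of_bool (exponents M = mset \<mu>) :: 'a)" if "\<mu> \<turnstile> n" for \<mu>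
  proof -
    have \<mu>: "0 \<notin> set \<mu>" "sum_list \<mu> = n" using that by (auto simp: partition_of_def)
    \<comment> \<open>Numbers in \<open>{1..n}\<close> that are not parts of \<mu> contribute the
      factor 0! = 1.\<close>
    have "set \<mu> \<subseteq> {1..n}"
      using \<mu> by (auto simp: Suc_le_eq intro: gr0I member_le_sum_list)
    then have "(\<Prod>i\<in>set \<mu>. fact (count_list \<mu> i)) = (\<Prod>i = 1..n. fact (count_list \<mu> i) :: 'a)"
      by (intro prod.mono_neutral_left) auto
    then have "(\<Sum>M\<in>msets Y n. of_bool (exponents M = mset \<mu>)) *
        (\<Prod>i = 1..n. fact (count_list \<mu> i)) = (fact (length \<mu>) * of_nat (Y choose length \<mu>) :: 'a)"
      using arg_cong[OF card_msets_exponents[of "mset \<mu>" Y], of "of_nat :: nat \<Rightarrow> 'a"] \<mu>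
      by (simp add: sum_mset_sum_list count_mset)
    also have "\<dots> = (\<Prod>j = 0..<length \<mu>. of_nat Y - of_nat j)"
      by (simp add: binomial_gbinomial gbinomial_mult_fact)
    finally show ?thesis by (simp add: field_simps)
  qed
  have "(\<Sum>\<mu> | \<mu> \<turnstile> n. (\<Prod>j = 0..<length \<mu>. of_nat Y - of_nat j) /
             (\<Prod>i = 1..n. fact (count_list \<mu> i)) * c (mset \<mu>)) =
      (\<Sum>\<mu> | \<mu> \<turnstile> n. \<Sum>M\<in>msets Y n. of_bool (exponents M = mset \<mu>) * c (mset \<mu>))"
    by (intro sum.cong) (simp_all only: mem_Collect_eq coef sum_distrib_right)
  also have "\<dots> = (\<Sum>M\<in>msets Y n. \<Sum>\<mu> | \<mu> \<turnstile> n. of_bool (exponents M = mset \<mu>) * c (mset \<mu>))"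
    by (rule sum.swap)
  also have "\<dots> = (\<Sum>M\<in>msets Y n. c (exponents M))"
  proof (rule sum.cong[OF refl])
    fix M assume "M \<in> msets Y n"
    then obtain \<mu> where \<mu>: "\<mu> \<turnstile> n" "mset \<mu> = exponents M"
      using ex_partition_mset[of "exponents M"] by (auto simp: size_exponents msets_def)
    have "(\<Sum>\<nu> | \<nu> \<turnstile> n. of_bool (exponents M = mset \<nu>) * c (mset \<nu>)) =
        (\<Sum>\<nu>\<in>{\<mu>}. of_bool (exponents M = mset \<nu>) * c (mset \<nu>))"
      using \<mu> by (intro sum.mono_neutral_right) (auto dest: partition_unique_list)
    then show "(\<Sum>\<nu> | \<nu> \<turnstile> n. of_bool (exponents M = mset \<nu>) * c (mset \<nu>)) = c (exponents M)"
      using \<mu> by simp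
  qed
  finally show ?thesis .
qed

section \<open>Polynomial functions\<close>

text \<open>A predicate on functions lets closure rules establish polynomiality of the explicit
  formulas below without constructing the polynomials.\<close>

definition polyfun :: "('a::comm_ring_1 \<Rightarrow> 'a) \<Rightarrow> bool" where
  "polyfun f \<longleftrightarrow> (\<exists>p. f = poly p)"

lemma polyfun_const: "polyfun (\<lambda>x. c)"
  unfolding polyfun_def by (rule exI[of _ "[:c:]"]) auto

lemma polyfun_ident: "polyfun (\<lambda>x. x)"
  unfolding polyfun_def by (rule exI[of _ "[:0, 1:]"]) auto

lemma polyfun_add: "polyfun f \<Longrightarrow> polyfun g \<Longrightarrow> polyfun (\<lambda>x. f x + g x)"
  unfolding polyfun_def by (auto simp flip: poly_add)

lemma polyfun_diff: "polyfun f \<Longrightarrow> polyfun g \<Longrightarrow> polyfun (\<lambda>x. f x - g x)"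
  unfolding polyfun_def by (auto simp flip: poly_diff)

lemma polyfun_mult: "polyfun f \<Longrightarrow> polyfun g \<Longrightarrow> polyfun (\<lambda>x. f x * g x)"
  unfolding polyfun_def by (auto simp flip: poly_mult)

lemma polyfun_divide:
  "polyfun f \<Longrightarrow> polyfun (\<lambda>x. f x / c)" for c :: "'a::field"
  unfolding divide_inverse by (rule polyfun_mult[OF _ polyfun_const])

lemma polyfun_power: "polyfun f \<Longrightarrow> polyfun (\<lambda>x. f x ^ n)"
  by (induction n) (auto intro: polyfun_const polyfun_mult)

lemma polyfun_sum: "(\<And>i. i \<in> A \<Longrightarrow> polyfun (f i)) \<Longrightarrow> polyfun (\<lambda>x. \<Sum>i\<in>A. f i x)"
  by (induction A rule: infinite_finite_induct) (auto intro: polyfun_const polyfun_mult polyfun_add)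

lemma polyfun_prod: "(\<And>i. i \<in> A \<Longrightarrow> polyfun (f i)) \<Longrightarrow> polyfun (\<lambda>x. \<Prod>i\<in>A. f i x)"
  by (induction A rule: infinite_finite_induct) (auto intro: polyfun_const polyfun_mult polyfun_add)

lemmas polyfun_intros = polyfun_const polyfun_ident polyfun_add polyfun_diff polyfun_mult
  polyfun_divide polyfun_power polyfun_sum polyfun_prod

text \<open>In characteristic 0 the positive integers are infinitely many distinct roots of the
  difference.\<close>

lemma polyfun_eqI:
  fixes f g :: "'a::field_char_0 \<Rightarrow> 'a"
  assumes "polyfun f" "polyfun g" "\<And>n. n > 0 \<Longrightarrow> f (of_nat n) = g (of_nat n)"
  shows "f = g"
proof -
  obtain p where p: "(\<lambda>x. f x - g x) = poly p"
    using polyfun_diff[OF assms(1,2)] by (auto simp: polyfun_def)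
  have "of_nat ` {0<..} \<subseteq> {x. poly p x = 0}"
    using assms(3) by (auto simp flip: p)
  moreover have "infinite (of_nat ` {0 :: nat<..} :: 'a set)"
    by (simp add: finite_image_iff inj_on_def infinite_Ioi)
  ultimately have "p = 0" by (metis finite_subset poly_roots_finite)
  then show ?thesis using p by (auto simp: fun_eq_iff)
qed

text \<open>This is the passage from \<open>Y\<close> ones to an arbitrary \<open>x\<close>. The
  product starts at j = 1, so it lacks the first factor of the falling factorial; the factor
  \<open>of_nat Y\<close> in the hypothesis supplies it and is cancelled for positive
  \<open>Y\<close>. Hence x = 0 is covered too.\<close>

lemma sum_partitions_eq_polyfun:
  fixes c :: "nat multiset \<Rightarrow> 'a::field_char_0"
  assumes "n > 0" "polyfun Q"
    and "\<And>Y. Y > 0 \<Longrightarrow> (\<Sum>M\<in>msets Y n. c (exponents M)) = of_nat Y * Q (of_nat Y)"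
  shows "(\<Sum>\<mu> | \<mu> \<turnstile> n. (\<Prod>j = 1..<length \<mu>. x - of_nat j) /
             (\<Prod>i = 1..n. fact (count_list \<mu> i)) * c (mset \<mu>)) = Q x"
proof -
  have "(\<lambda>x. \<Sum>\<mu> | \<mu> \<turnstile> n. (\<Prod>j = 1..<length \<mu>. x - of_nat j) /
             (\<Prod>i = 1..n. fact (count_list \<mu> i)) * c (mset \<mu>)) = Q"
  proof (rule polyfun_eqI)
    fix Y :: nat assume Y: "Y > 0"
    have "(\<Prod>j = 0..<length \<mu>. of_nat Y - of_nat j :: 'a) =
        of_nat Y * (\<Prod>j = 1..<length \<mu>. of_nat Y - of_nat j)" if "\<mu> \<turnstile> n" for \<mu>
    proof -
      have "length \<mu> > 0" using that assms(1) by (auto simp: partition_of_def)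
      then show ?thesis by (simp add: prod.atLeast_Suc_lessThan)
    qed
    then have "of_nat Y * (\<Sum>\<mu> | \<mu> \<turnstile> n. (\<Prod>j = 1..<length \<mu>. of_nat Y - of_nat j) /
             (\<Prod>i = 1..n. fact (count_list \<mu> i)) * c (mset \<mu>)) = of_nat Y * Q (of_nat Y)"
      using sum_partitions_eq_sum_msets[where n = n and Y = Y and c = c] assms(3)[OF Y]
      by (simp add: sum_distrib_left mult.assoc)
    then show "(\<Sum>\<mu> | \<mu> \<turnstile> n. (\<Prod>j = 1..<length \<mu>. of_nat Y - of_nat j) /
             (\<Prod>i = 1..n. fact (count_list \<mu> i)) * c (mset \<mu>)) = Q (of_nat Y)"
      using Y by simp
  qed (use assms in \<open>auto intro!: polyfun_intros\<close>)
  then show ?thesis by (rule fun_cong)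
qed

section \<open>The monomial basis\<close>

lemma symfun_eqI: "(\<And>M. coeff f M = coeff g M) \<Longrightarrow> f = g"
  by (simp add: coeff_inject[symmetric] fun_eq_iff)

lemmas coeff_simps = zero_symfun.rep_eq one_symfun.rep_eq plus_symfun.rep_eq
  minus_symfun.rep_eq times_symfun.rep_eq smult.rep_eq m_part.rep_eq h_sym.rep_eq

lemma coeff_sum: "coeff (\<Sum>i\<in>A. f i) M = (\<Sum>i\<in>A. coeff (f i) M)"
  by (induction A rule: infinite_finite_induct) (simp_all add: coeff_simps)

lemma smult_mult_left: "smult c f * g = smult c (f * g)"
  by (rule symfun_eqI) (simp add: coeff_simps sum_distrib_left mult.assoc)

lemma smult_mult_right: "f * smult c g = smult c (f * g)"
  by (metis mult.commute smult_mult_left)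

text \<open>Monomials with equal exponents differ by a permutation of the finite set
  \<open>A\<close> of variables occurring in either of them, and symmetric functions are invariant
  under it.\<close>

lemma coeff_eq_of_exponents_eq:
  assumes "exponents M = exponents M'"
  shows "coeff f M = coeff f M'"
proof -
  define A where "A = set_mset M \<union> set_mset M'"
  have fin: "finite A" by (simp add: A_def)
  \<comment> \<open>Listing exponents over all of \<open>A\<close> pads them with zeros, which makes
    the families for \<open>M\<close> and \<open>M'\<close> comparable.\<close>
  have *: "image_mset (count K) (mset_set A) =
      exponents K + replicate_mset (card A - size (exponents K)) 0" if "set_mset K \<subseteq> A" for K
  proof -
    have "mset_set A = mset_set (set_mset K) + mset_set (A - set_mset K)"
      using that fin by (subst mset_set_Union[symmetric]) (auto simp: Un_absorb1 finite_subset)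
    moreover have "image_mset (count K) (mset_set (A - set_mset K)) =
        image_mset (\<lambda>_. 0) (mset_set (A - set_mset K))"
      using fin by (intro image_mset_cong) (auto simp: count_eq_zero_iff)
    moreover have "card (A - set_mset K) = card A - size (exponents K)"
      using that fin by (simp add: exponents_def card_Diff_subset)
    ultimately show ?thesis by (simp add: exponents_def image_mset_const_eq)
  qed
  have "image_mset (count M) (mset_set A) = image_mset (count M') (mset_set A)"
    using *[of M] *[of M'] assms by (metis A_def Un_upper1 Un_upper2)
  then obtain p where p: "p permutes A" "\<forall>x\<in>A. count M x = count M' (p x)"
    using image_mset_eq_implies_permutes[OF fin] by blast
  have inv: "inv p permutes A" using p(1) by (rule permutes_inv)
  have "count (image_mset p M) x = count M' x" for x
  proof -
    have "p -` {x} = {inv p x}"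
      using permutes_inverses[OF p(1)] by auto
    then have "count (image_mset p M) x = count M (inv p x)"
      by (cases "inv p x \<in># M") (auto simp: count_image_mset count_eq_zero_iff)
    also have "\<dots> = count M' x"
    proof (cases "x \<in> A")
      case True
      then have "inv p x \<in> A" using permutes_in_image[OF inv] by simp
      then show ?thesis using p(2) permutes_inverses[OF p(1)] by simp
    next
      case False
      then have "inv p x = x" using inv by (simp add: permutes_not_in)
      moreover have "x \<notin># M" "x \<notin># M'" using False by (auto simp: A_def)
      ultimately show ?thesis by (simp add: not_in_iff)
    qed
    finally show ?thesis .
  qed
  then have "image_mset p M = M'" by (rule multiset_eqI)
  moreover have "bij p" using p(1) by (rule permutes_bij)
  ultimately show ?thesis using coeff[of f] by auto
qed

lemma ex_exponents:
  assumes "0 \<notin># \<nu>"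
  shows "\<exists>M. exponents M = \<nu>"
  using assms
proof (induction \<nu>)
  case empty
  then show ?case by (intro exI[of _ "{#}"]) simp
next
  case (add p \<nu>)
  then obtain M where M: "exponents M = \<nu>" by auto
  obtain x where "x \<notin> set_mset M" using ex_new_if_finite[OF infinite_UNIV_nat] by blast
  with M add show ?case
    by (intro exI[of _ "replicate_mset p x + M"]) (simp add: exponents_replicate_add)
qed

section \<open>Coefficients with respect to the monomial basis\<close>

definition mcoeff :: "'a::comm_ring_1 symfun \<Rightarrow> nat multiset \<Rightarrow> 'a" where
  "mcoeff f \<nu> = coeff f (SOME M. exponents M = \<nu>)"

lemma mcoeff_exponents [simp]: "mcoeff f (exponents M) = coeff f M"
  unfolding mcoeff_def
  by (rule coeff_eq_of_exponents_eq, rule someI[where P = "\<lambda>M'. exponents M' = exponents M"]) simp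

text \<open>Bounding the size gives finite index sets, so that spanning sets and independent sets
  can be compared by cardinality.\<close>

definition partitions_le :: "nat \<Rightarrow> nat list set" where
  "partitions_le d = {\<mu>. \<exists>a\<le>d. \<mu> \<turnstile> a}"

lemma finite_partitions_le [simp]: "finite (partitions_le d)"
proof -
  have "partitions_le d = (\<Union>a\<le>d. {\<mu>. \<mu> \<turnstile> a})" by (auto simp: partitions_le_def)
  then show ?thesis by simp
qed

lemma partitions_le_mono: "d \<le> e \<Longrightarrow> partitions_le d \<subseteq> partitions_le e"
  unfolding partitions_le_def by (blast intro: order_trans)

lemma mset_inj_partitions:
  "\<mu> \<in> partitions_le d \<Longrightarrow> \<nu> \<in> partitions_le e \<Longrightarrow> mset \<mu> = mset \<nu> \<longleftrightarrow> \<mu> = \<nu>"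
  by (auto simp: partitions_le_def dest: partition_unique_list)

text \<open>At a given monomial only the partition formed by its exponents contributes; the degree
  bound makes the sum finite.\<close>

lemma symfun_expand_m_part:
  assumes "\<And>M. coeff f M \<noteq> 0 \<Longrightarrow> size M \<le> d"
  shows "f = (\<Sum>\<mu>\<in>partitions_le d. smult (mcoeff f (mset \<mu>)) (m_part \<mu>))"
proof (rule symfun_eqI)
  fix M
  show "coeff f M = coeff (\<Sum>\<mu>\<in>partitions_le d. smult (mcoeff f (mset \<mu>)) (m_part \<mu>)) M"
  proof (cases "coeff f M = 0")
    case True
    then have "mcoeff f (mset \<mu>) = 0" if "exponents M = mset \<mu>" for \<mu>
      by (metis that mcoeff_exponents)
    then show ?thesis using True by (auto simp: coeff_sum coeff_simps intro!: sum.neutral)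
  next
    case False
    then have "size M \<le> d" by (rule assms)
    obtain \<mu> where \<mu>': "\<mu> \<turnstile> size M" "mset \<mu> = exponents M"
      using ex_partition_mset[of "exponents M"] by (auto simp: size_exponents)
    with \<open>size M \<le> d\<close> have \<mu>: "\<mu> \<in> partitions_le d" "mset \<mu> = exponents M"
      by (auto simp: partitions_le_def)
    have iff: "exponents M = mset \<nu> \<longleftrightarrow> \<nu> = \<mu>" if "\<nu> \<in> partitions_le d" for \<nu>
      using mset_inj_partitions[OF that \<mu>(1)] \<mu>(2) by auto
    have "coeff (\<Sum>\<mu>\<in>partitions_le d. smult (mcoeff f (mset \<mu>)) (m_part \<mu>)) M =
        (\<Sum>\<nu>\<in>partitions_le d. mcoeff f (mset \<nu>) * of_bool (\<nu> = \<mu>))"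
      unfolding coeff_sum by (rule sum.cong[OF refl]) (simp add: coeff_simps iff)
    also have "\<dots> = (\<Sum>\<nu>\<in>{\<mu>}. mcoeff f (mset \<nu>) * of_bool (\<nu> = \<mu>))"
      by (rule sum.mono_neutral_right) (use \<mu> in auto)
    also have "\<dots> = coeff f M" using \<mu> by simp
    finally show ?thesis by simp
  qed
qed

lemma coeff_m_part_eq_0:
  assumes "coeff (m_part \<mu>) M \<noteq> 0" "\<mu> \<in> partitions_le d"
  shows "size M \<le> d"
proof -
  have "exponents M = mset \<mu>" using assms(1) by (auto simp: coeff_simps split: if_splits)
  then have "size M = sum_list \<mu>" by (metis size_exponents sum_mset_sum_list)
  then show ?thesis using assms(2) by (auto simp: partitions_le_def partition_of_def)
qed

lemma mcoeff_m_part: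
  assumes "\<mu> \<in> partitions_le d" "\<nu> \<in> partitions_le e"
  shows "mcoeff (m_part \<mu>) (mset \<nu>) = of_bool (\<mu> = \<nu>)"
proof -
  obtain M where "exponents M = mset \<nu>"
    using ex_exponents[of "mset \<nu>"] assms(2) by (auto simp: partitions_le_def partition_of_def)
  moreover have "mset \<nu> = mset \<mu> \<longleftrightarrow> \<mu> = \<nu>"
    using mset_inj_partitions[OF assms] by auto
  ultimately show ?thesis
    using mcoeff_exponents[of "m_part \<mu>" M] by (cases "\<mu> = \<nu>") (auto simp: coeff_simps)
qed

lemma inj_on_m_part: "inj_on (m_part :: _ \<Rightarrow> 'a::comm_ring_1 symfun) (partitions_le d)"
proof (rule inj_onI)
  fix \<mu> \<nu>
  assume \<mu>\<nu>: "\<mu> \<in> partitions_le d" "\<nu> \<in> partitions_le d"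
    and eq: "(m_part \<mu> :: 'a symfun) = m_part \<nu>"
  have "(of_bool (\<nu> = \<mu>) :: 'a) = mcoeff (m_part \<mu>) (mset \<mu>)"
    unfolding eq by (rule mcoeff_m_part[OF \<mu>\<nu>(2,1), symmetric])
  also have "\<dots> = 1"
    using mcoeff_m_part[OF \<mu>\<nu>(1,1)] by simp
  finally show "\<mu> = \<nu>" by (auto split: if_splits)
qed

lemma mcoeff_add: "mcoeff (f + g) \<nu> = mcoeff f \<nu> + mcoeff g \<nu>"
  by (simp add: mcoeff_def coeff_simps)

lemma mcoeff_smult: "mcoeff (smult c f) \<nu> = c * mcoeff f \<nu>"
  by (simp add: mcoeff_def coeff_simps)

lemma mcoeff_sum: "mcoeff (\<Sum>i\<in>A. f i) \<nu> = (\<Sum>i\<in>A. mcoeff (f i) \<nu>)"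
  by (simp add: mcoeff_def coeff_sum)

lemma independent_m_part: "symfun.independent (m_part ` partitions_le d :: 'a::field symfun set)"
proof (rule symfun.independent_if_scalars_zero)
  fix u :: "'a symfun \<Rightarrow> 'a" and x :: "'a symfun"
  assume 0: "(\<Sum>x\<in>m_part ` partitions_le d. smult (u x) x) = (0 :: 'a symfun)"
    and "x \<in> m_part ` partitions_le d"
  then obtain \<nu> where \<nu>: "\<nu> \<in> partitions_le d" "x = m_part \<nu>" by auto
  have "0 = mcoeff (\<Sum>x\<in>m_part ` partitions_le d. smult (u x) x) (mset \<nu>)"
    unfolding 0 by (simp add: mcoeff_def coeff_simps)
  also have "\<dots> = (\<Sum>\<mu>\<in>partitions_le d. mcoeff (smult (u (m_part \<mu>)) (m_part \<mu>)) (mset \<nu>))"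
    by (simp add: sum.reindex inj_on_m_part mcoeff_sum)
  also have "\<dots> = (\<Sum>\<mu>\<in>partitions_le d. u (m_part \<mu>) * of_bool (\<mu> = \<nu>))"
    using \<nu> by (intro sum.cong) (auto simp: mcoeff_smult mcoeff_m_part)
  also have "\<dots> = (\<Sum>\<mu>\<in>{\<nu>}. u (m_part \<mu>) * of_bool (\<mu> = \<nu>))"
    by (rule sum.mono_neutral_right) (use \<nu> in auto)
  finally show "u x = 0" using \<nu> by simp
qed simp

section \<open>The complete homogeneous basis\<close>

lemma h_part_mset: "h_part \<mu> = (\<Prod>i\<in>#mset \<mu>. h_sym i)"
  by (simp add: h_part_def prod_mset_prod_list flip: mset_map)

definition h_span :: "nat \<Rightarrow> 'a::field symfun set" where
  "h_span d = symfun.span (h_part ` partitions_le d)"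

lemma h_span_mono: "d \<le> e \<Longrightarrow> h_span d \<subseteq> h_span e"
  unfolding h_span_def by (intro symfun.span_mono image_mono partitions_le_mono)

text \<open>The product of two \<open>h_part\<close> is the \<open>h_part\<close> of the merged
  partition, whose size is the sum of the sizes. Linearity in each factor does the rest.\<close>

lemma h_span_mult:
  assumes "f \<in> h_span d" "g \<in> h_span e"
  shows "f * g \<in> h_span (d + e)"
proof -
  have hh: "h_part \<mu> * h_part \<nu> \<in> h_span (d + e)"
    if "\<mu> \<in> partitions_le d" "\<nu> \<in> partitions_le e" for \<mu> \<nu>
  proof -
    have "0 \<notin># mset \<mu> + mset \<nu>" and le: "sum_list \<mu> + sum_list \<nu> \<le> d + e"
      using that by (auto simp: partitions_le_def partition_of_def)
    then obtain \<rho> where \<rho>: "\<rho> \<turnstile> sum_mset (mset \<mu> + mset \<nu>)" "mset \<rho> = mset \<mu> + mset \<nu>"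
      using ex_partition_mset by metis
    have "\<rho> \<in> partitions_le (d + e)"
      using \<rho>(1) le by (auto simp: partitions_le_def sum_mset_sum_list)
    then have "h_part \<rho> \<in> h_span (d + e)"
      unfolding h_span_def by (intro symfun.span_base imageI)
    then show ?thesis by (simp add: h_part_mset \<rho>)
  qed
  have left: "h_part \<mu> * g \<in> h_span (d + e)" if \<mu>: "\<mu> \<in> partitions_le d" for \<mu>
    using assms(2) unfolding h_span_def[of e]
  proof (rule symfun.span_induct)
    show "symfun.subspace {g. h_part \<mu> * g \<in> h_span (d + e)}"
      unfolding h_span_def
      by (rule symfun.subspaceI)
        (auto simp: distrib_left smult_mult_right symfun.span_zero symfun.span_add symfun.span_scale)
  qed (use hh \<mu> in auto)
  show ?thesis
    using assms(1) unfolding h_span_def[of d]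
  proof (rule symfun.span_induct)
    show "symfun.subspace {f. f * g \<in> h_span (d + e)}"
      unfolding h_span_def
      by (rule symfun.subspaceI)
        (auto simp: distrib_right smult_mult_left symfun.span_zero symfun.span_add symfun.span_scale)
  qed (use left in auto)
qed

lemma h_sym_in_h_span: "h_sym n \<in> h_span n"
proof (cases "n = 0")
  case True
  have "(h_sym 0 :: 'a symfun) = h_part []"
    by (rule symfun_eqI) (simp add: h_part_def coeff_simps)
  moreover have "[] \<in> partitions_le 0" by (auto simp: partitions_le_def partition_of_def)
  ultimately show ?thesis using True unfolding h_span_def by (auto intro!: symfun.span_base)
next
  case False
  then have "[n] \<in> partitions_le n" by (auto simp: partitions_le_def partition_of_def)
  then have "h_part [n] \<in> h_span n" unfolding h_span_def by (intro symfun.span_base imageI)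
  then show ?thesis by (simp add: h_part_def)
qed

section \<open>Power sums and Newton's identities\<close>

lemma exponents_eq_single_iff:
  assumes "k > 0"
  shows "exponents A = {#k#} \<longleftrightarrow> (\<exists>x. A = replicate_mset k x)"
proof
  assume e: "exponents A = {#k#}"
  then have "card (set_mset A) = 1" by (metis exponents_def size_image_mset size_mset_set size_single)
  then obtain x where x: "set_mset A = {x}" by (auto simp: card_1_singleton_iff)
  then have "exponents A = {#count A x#}" by (simp add: exponents_def)
  with e have "count A x = k" by simp
  then have "A = replicate_mset k x"
    using x by (intro multiset_eqI) (auto simp: count_eq_zero_iff)
  then show "\<exists>x. A = replicate_mset k x" by blast
next
  assume "\<exists>x. A = replicate_mset k x"
  then obtain x where "A = replicate_mset k x + {#}" by auto
  then show "exponents A = {#k#}" using assms exponents_replicate_add[of x "{#}" k] by simp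
qed

text \<open>For positive \<open>k\<close>, \<open>m_part [k]\<close> is the power sum p_k, so its
  product with \<open>f\<close> collects one term for each variable whose k-th power divides the
  monomial.\<close>

lemma coeff_power_sum_mult:
  assumes "k > 0"
  shows "coeff (m_part [k] * f) M = (\<Sum>x | k \<le> count M x. coeff f (M - replicate_mset k x))"
proof -
  have sub: "replicate_mset k x \<subseteq># M \<longleftrightarrow> k \<le> count M x" for x
    by (simp add: count_le_replicate_mset_subset_eq)
  have inj: "inj_on (replicate_mset k) {x. k \<le> count M x}"
    using assms by (auto simp: inj_on_def replicate_mset_eq_iff)
  have "coeff (m_part [k] * f) M =
      (\<Sum>A | A \<subseteq># M. of_bool (exponents A = {#k#}) * coeff f (M - A))"
    by (auto simp: coeff_simps intro!: sum.cong)
  also have "\<dots> = (\<Sum>A\<in>replicate_mset k ` {x. k \<le> count M x}.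
      of_bool (exponents A = {#k#}) * coeff f (M - A))"
    by (rule sum.mono_neutral_right)
      (auto simp: finite_submultisets exponents_eq_single_iff[OF assms] sub)
  also have "\<dots> = (\<Sum>A\<in>replicate_mset k ` {x. k \<le> count M x}. coeff f (M - A))"
    by (rule sum.cong) (auto simp: exponents_eq_single_iff[OF assms])
  also have "\<dots> = (\<Sum>x | k \<le> count M x. coeff f (M - replicate_mset k x))"
    by (simp add: sum.reindex inj)
  finally show ?thesis .
qed

lemma finite_count_ge: "k > 0 \<Longrightarrow> finite {x. k \<le> count M x}"
  by (rule finite_subset[of _ "set_mset M"]) (auto intro: ccontr simp: not_in_iff)

text \<open>For a monomial of degree \<open>n\<close> the right-hand side counts the pairs of a
  variable \<open>x\<close> and some i \<ge> 1 such that the i-th power of \<open>x\<close> divides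
  it. Each variable gives as many pairs as its exponent, hence \<open>n\<close> in total.\<close>

lemma newton_h_p:
  "smult (of_nat n) (h_sym n :: 'a::comm_ring_1 symfun) =
    (\<Sum>i = 1..n. m_part [i] * h_sym (n - i))"
proof (rule symfun_eqI)
  fix M :: "nat multiset"
  have sub: "{x. i \<le> count M x} \<subseteq> set_mset M" if "i \<ge> 1" for i
    using that by (auto intro: ccontr simp: not_in_iff)
  have "coeff (m_part [i] * h_sym (n - i)) M =
      (of_bool (size M = n) * (\<Sum>x\<in>set_mset M. of_bool (i \<le> count M x)) :: 'a)"
    if i: "i \<in> {1..n}" for i
  proof -
    have "coeff (m_part [i] * h_sym (n - i)) M =
        (\<Sum>x | i \<le> count M x. coeff (h_sym (n - i)) (M - replicate_mset i x) :: 'a)"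
      using i by (intro coeff_power_sum_mult) auto
    also have "\<dots> = (\<Sum>x | i \<le> count M x. of_bool (size M = n))"
    proof (rule sum.cong[OF refl])
      fix x assume x: "x \<in> {x. i \<le> count M x}"
      then have "size (M - replicate_mset i x) = size M - i"
        by (subst size_Diff_submset) (auto simp: count_le_replicate_mset_subset_eq)
      moreover have "i \<le> size M" using x by (auto intro: order_trans[OF _ count_le_size])
      ultimately show "coeff (h_sym (n - i)) (M - replicate_mset i x) = (of_bool (size M = n) :: 'a)"
        using i by (auto simp: coeff_simps)
    qed
    also have "\<dots> = of_bool (size M = n) * (\<Sum>x | i \<le> count M x. 1)"
      by (simp add: sum_distrib_left)
    also have "(\<Sum>x | i \<le> count M x. 1) = (\<Sum>x\<in>set_mset M. of_bool (i \<le> count M x) :: 'a)"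
      using i sub[of i] by (intro sum.mono_neutral_cong_left) auto
    finally show ?thesis .
  qed
  then have "coeff (\<Sum>i = 1..n. m_part [i] * h_sym (n - i)) M =
      of_bool (size M = n) * (\<Sum>i = 1..n. \<Sum>x\<in>set_mset M. of_bool (i \<le> count M x) :: 'a)"
    by (simp add: coeff_sum sum_distrib_left del: sum_of_bool_eq)
  also have "\<dots> = of_bool (size M = n) * (\<Sum>x\<in>set_mset M. \<Sum>i = 1..n. of_bool (i \<le> count M x))"
    by (subst sum.swap) simp
  also have "\<dots> = of_bool (size M = n) * of_nat (size M)"
  proof (cases "size M = n")
    case True
    have "(\<Sum>i = 1..n. of_bool (i \<le> count M x) :: 'a) = of_nat (count M x)" for x
    proof -
      have "{1..n} \<inter> {i. i \<le> count M x} = {1..count M x}"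
        using True count_le_size[of M x] by auto
      then show ?thesis by simp
    qed
    then show ?thesis by (simp add: size_multiset_overloaded_eq del: sum_of_bool_eq)
  qed simp
  finally show "coeff (smult (of_nat n) (h_sym n :: 'a symfun)) M =
      coeff (\<Sum>i = 1..n. m_part [i] * h_sym (n - i)) M"
    by (auto simp: coeff_simps)
qed

lemma power_sum_in_h_span:
  assumes "n > 0"
  shows "(m_part [n] :: 'a::field symfun) \<in> h_span n"
  using assms
proof (induction n rule: less_induct)
  case (less n)
  have h0: "(h_sym 0 :: 'a symfun) = 1"
    by (rule symfun_eqI) (simp add: coeff_simps)
  have "smult (of_nat n) (h_sym n) =
      (\<Sum>i = 1..<n. m_part [i] * h_sym (n - i)) + (m_part [n] :: 'a symfun)"
  proof -
    have "{1..n} = insert n {1..<n}" using less.prems by auto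
    then show ?thesis by (simp add: newton_h_p h0)
  qed
  then have eq: "(m_part [n] :: 'a symfun) = smult (of_nat n) (h_sym n) -
      (\<Sum>i = 1..<n. m_part [i] * h_sym (n - i))"
    by simp
  have "m_part [i] * h_sym (n - i) \<in> (h_span n :: 'a symfun set)" if "i \<in> {1..<n}" for i
    using h_span_mult[OF less.IH[of i] h_sym_in_h_span[of "n - i"]] that by auto
  moreover have "(h_sym n :: 'a symfun) \<in> h_span n" by (rule h_sym_in_h_span)
  ultimately show ?case
    unfolding eq h_span_def
    by (intro symfun.span_diff symfun.span_scale symfun.span_sum) auto
qed

text \<open>Induction on the number of parts: \<open>m_part [k] * m_part \<kappa>\<close> is a
  multiple of \<open>m_part \<mu>\<close> plus a remainder \<open>g\<close> that involves only
  partitions with fewer parts than \<mu>.\<close>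

lemma m_part_in_h_span:
  assumes "\<mu> \<in> partitions_le d"
  shows "(m_part \<mu> :: 'a::field_char_0 symfun) \<in> h_span d"
  using assms
proof (induction "length \<mu>" arbitrary: \<mu> d rule: less_induct)
  case less
  show ?case
  proof (cases \<mu>)
    case Nil
    then have "(m_part \<mu> :: 'a symfun) = h_sym 0"
      by (intro symfun_eqI) (auto simp: coeff_simps exponents_def mset_set_empty_iff)
    moreover have "h_sym 0 \<in> (h_span d :: 'a symfun set)"
      using h_sym_in_h_span[of 0] h_span_mono[of 0 d] by auto
    ultimately show ?thesis by simp
  next
    case (Cons k \<kappa>)
    obtain a where "a \<le> d" "\<mu> \<turnstile> a" using less.prems by (auto simp: partitions_le_def)
    then have k: "k > 0" and kd: "k \<le> d" and \<kappa>: "\<kappa> \<in> partitions_le (d - k)"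
      unfolding Cons by (auto simp: partitions_le_def partition_of_def)
    \<comment> \<open>A monomial of type \<mu> arises in the product once for every variable with
      exponent exactly \<open>k\<close>. This number is invertible in characteristic 0.\<close>
    define c where "c = count (mset \<mu>) k"
    have c: "c > 0" by (simp add: c_def Cons)
    define g where "g = m_part [k] * m_part \<kappa> - smult (of_nat c) (m_part \<mu> :: 'a symfun)"
    have card_exp: "size (exponents M) = card (set_mset M)" for M
      by (simp add: exponents_def)
    text \<open>Adding \<open>k\<close> to a part that is already there does not create a new part.\<close>
    have g_len: "card (set_mset M) \<le> length \<kappa>" if g0: "coeff g M \<noteq> 0" for M
    proof (rule ccontr)
      assume long: "\<not> card (set_mset M) \<le> length \<kappa>"
      have new: "exponents (M - replicate_mset k x) = mset \<kappa> \<longleftrightarrow>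
          count M x = k \<and> exponents M = mset \<mu>" if x: "k \<le> count M x" for x
      proof (cases "count M x = k")
        case True
        have "x \<notin># M - replicate_mset k x" using True by (simp add: count_eq_zero_iff[symmetric])
        moreover have "replicate_mset k x + (M - replicate_mset k x) = M"
          using x by (simp add: count_le_replicate_mset_subset_eq subset_mset.add_diff_inverse)
        ultimately have "exponents M = add_mset k (exponents (M - replicate_mset k x))"
          using exponents_replicate_add[of x "M - replicate_mset k x" k] k by simp
        then show ?thesis using True by (simp add: Cons)
      next
        case False
        then have "set_mset (M - replicate_mset k x) = set_mset M"
          using x by (intro set_eqI)
            (simp flip: count_greater_zero_iff, linarith?)
        then have "size (exponents (M - replicate_mset k x)) \<noteq> size (mset \<kappa>)"
          using long by (simp add: card_exp)
        then show ?thesis using False by metis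
      qed
      have "coeff (m_part [k] * m_part \<kappa>) M =
          (\<Sum>x | k \<le> count M x. of_bool (count M x = k \<and> exponents M = mset \<mu>) :: 'a)"
        unfolding coeff_power_sum_mult[OF k] by (rule sum.cong) (auto simp: coeff_simps new)
      also have "\<dots> = (\<Sum>x | k \<le> count M x. of_bool (count M x = k)) * of_bool (exponents M = mset \<mu>)"
        by (simp only: of_bool_conj sum_distrib_right)
      also have "(\<Sum>x | k \<le> count M x. of_bool (count M x = k)) = of_nat (count (exponents M) k)"
      proof -
        have "{x. k \<le> count M x} \<inter> {x. count M x = k} = count M -` {k} \<inter> set_mset M"
          using k by (auto intro: ccontr simp: not_in_iff)
        then show ?thesis
          using k by (simp add: exponents_def count_image_mset finite_count_ge)
      qed
      finally have "coeff g M = 0"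
        by (auto simp: g_def c_def coeff_simps)
      with g0 show False by simp
    qed
    have g_deg: "size M \<le> d" if "coeff g M \<noteq> 0" for M
    proof (rule ccontr)
      assume long: "\<not> size M \<le> d"
      have "coeff (m_part \<mu> :: 'a symfun) M = 0"
        using coeff_m_part_eq_0[OF _ less.prems, of M] long by auto
      moreover have "coeff (m_part \<kappa> :: 'a symfun) (M - replicate_mset k x) = 0"
        if "k \<le> count M x" for x
      proof -
        have "size (M - replicate_mset k x) = size M - k"
          using that by (subst size_Diff_submset) (auto simp: count_le_replicate_mset_subset_eq)
        then show ?thesis
          using coeff_m_part_eq_0[OF _ \<kappa>, of "M - replicate_mset k x"] long kd by fastforce
      qed
      ultimately have "coeff g M = 0"
        unfolding g_def minus_symfun.rep_eq coeff_power_sum_mult[OF k] by (simp add: coeff_simps)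
      with that show False by simp
    qed
    have "g \<in> h_span d"
    proof -
      have "smult (mcoeff g (mset \<nu>)) (m_part \<nu>) \<in> h_span d" if \<nu>: "\<nu> \<in> partitions_le d" for \<nu>
      proof (cases "mcoeff g (mset \<nu>) = 0")
        case True
        then show ?thesis by (simp add: h_span_def symfun.span_zero)
      next
        case False
        obtain M where M: "exponents M = mset \<nu>"
          using ex_exponents[of "mset \<nu>"] \<nu> by (auto simp: partitions_le_def partition_of_def)
        then have "coeff g M \<noteq> 0" using False by (metis mcoeff_exponents)
        then have "card (set_mset M) \<le> length \<kappa>" by (rule g_len)
        then have "length \<nu> < length \<mu>" using card_exp[of M] M Cons by simp
        then have "m_part \<nu> \<in> (h_span d :: 'a symfun set)" using less.hyps \<nu> by blast
        then show ?thesis by (simp add: h_span_def symfun.span_scale)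
      qed
      then show ?thesis
        by (subst symfun_expand_m_part[of g d, OF g_deg])
          (auto simp: h_span_def intro: symfun.span_sum)
    qed
    moreover have "m_part [k] * m_part \<kappa> \<in> (h_span d :: 'a symfun set)"
      using h_span_mult[OF power_sum_in_h_span[OF k] less.hyps[OF _ \<kappa>]] kd Cons by simp
    moreover have "m_part \<mu> = smult (inverse (of_nat c)) (m_part [k] * m_part \<kappa> - g)"
      using c by (simp add: g_def)
    ultimately show ?thesis
      by (simp add: h_span_def symfun.span_diff symfun.span_scale)
  qed
qed

section \<open>The \<open>h_part\<close> form a basis\<close>

text \<open>The span of the \<open>h_part\<close> contains as many independent elements
  \<open>m_part \<mu>\<close> as there are indices. A maximal independent subset \<open>B\<close> of
  the \<open>h_part\<close> therefore has at least that many elements, so it is everything and no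
  two indices give the same element.\<close>

lemma independent_h_part_le:
  "symfun.independent (h_part ` partitions_le d :: 'a::field_char_0 symfun set)"
  and inj_on_h_part_le: "inj_on (h_part :: _ \<Rightarrow> 'a symfun) (partitions_le d)"
proof -
  let ?H = "h_part ` partitions_le d :: 'a symfun set"
  let ?M = "m_part ` partitions_le d :: 'a symfun set"
  obtain B where B: "B \<subseteq> ?H" "symfun.independent B" "?H \<subseteq> symfun.span B"
    using symfun.maximal_independent_subset by blast
  have fin: "finite B" using B(1) by (rule finite_subset) simp
  have "?M \<subseteq> symfun.span ?H"
    using m_part_in_h_span by (auto simp: h_span_def)
  also have "\<dots> \<subseteq> symfun.span B"
    using symfun.span_mono[OF B(3)] by (simp add: symfun.span_span)
  finally have "card ?M \<le> card B"
    using symfun.independent_span_bound[OF fin independent_m_part] by simp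
  then have le: "card (partitions_le d) \<le> card B"
    by (simp add: card_image inj_on_m_part)
  have "card ?H \<le> card (partitions_le d)" by (rule card_image_le) simp
  with le have "B = ?H" using B(1) by (intro card_seteq) auto
  with B(2) show "symfun.independent ?H" by simp
  show "inj_on (h_part :: _ \<Rightarrow> 'a symfun) (partitions_le d)"
    using le \<open>B = ?H\<close> \<open>card ?H \<le> card (partitions_le d)\<close> by (intro eq_card_imp_inj_on) auto
qed

abbreviation partitions :: "nat list set" where
  "partitions \<equiv> \<Union>d. partitions_le d"

text \<open>The sets \<open>partitions_le d\<close> form a chain, so injectivity, and likewise
  independence in the next lemma, passes to their union.\<close>

lemma inj_on_h_part: "inj_on (h_part :: _ \<Rightarrow> 'a::field_char_0 symfun) partitions"
  by (rule inj_on_UNION_chain)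
    (use partitions_le_mono nat_le_linear in \<open>blast intro: inj_on_h_part_le\<close>)+

lemma independent_h_part:
  "symfun.independent (h_part ` partitions :: 'a::field_char_0 symfun set)"
proof -
  have "symfun.independent (\<Union>d. h_part ` partitions_le d :: 'a symfun set)"
    by (rule symfun.independent_Union_directed)
      (auto simp: independent_h_part_le,
        meson image_mono nat_le_linear partitions_le_mono subsetD imageI)
  then show ?thesis by (simp add: image_UN)
qed

lemma ex_degree_bound: "\<exists>d. \<forall>M. coeff f M \<noteq> 0 \<longrightarrow> size M \<le> d"
  using coeff[of f] by auto

lemma span_h_part: "f \<in> symfun.span (h_part ` partitions :: 'a::field_char_0 symfun set)"
proof -
  obtain d where d: "\<And>M. coeff f M \<noteq> 0 \<Longrightarrow> size M \<le> d" using ex_degree_bound by blast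
  have "f \<in> h_span d"
    by (subst symfun_expand_m_part[of f d, OF d])
      (auto simp: h_span_def intro!: symfun.span_sum symfun.span_scale
        m_part_in_h_span[unfolded h_span_def])
  moreover have "h_span d \<subseteq> symfun.span (h_part ` partitions :: 'a symfun set)"
    unfolding h_span_def by (intro symfun.span_mono) auto
  ultimately show ?thesis by blast
qed

section \<open>Existence and uniqueness of the Hall form\<close>

lemma is_hall_formD:
  assumes "is_hall_form B"
  shows "B (f + f') g = B f g + B f' g" "B (smult c f) g = c * B f g"
    and "B f (g + g') = B f g + B f g'" "B f (smult c g) = c * B f g"
    and "\<nu> \<turnstile> a \<Longrightarrow> \<mu> \<turnstile> b \<Longrightarrow> B (h_part \<nu>) (m_part \<mu>) = of_bool (\<nu> = \<mu>)"
  using assms unfolding is_hall_form_def Vector_Spaces.linear_iff of_bool_def by blast+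

lemma is_hall_form_sum:
  assumes "is_hall_form B"
  shows "B (\<Sum>i\<in>A. f i) g = (\<Sum>i\<in>A. B (f i) g)" "B f' (\<Sum>i\<in>A. f i) = (\<Sum>i\<in>A. B f' (f i))"
proof -
  have "B 0 g = 0" "B f' 0 = 0"
    using is_hall_formD(2)[OF assms, of 0 0 g] is_hall_formD(4)[OF assms, of f' 0 0] by simp_all
  then show "B (\<Sum>i\<in>A. f i) g = (\<Sum>i\<in>A. B (f i) g)" "B f' (\<Sum>i\<in>A. f i) = (\<Sum>i\<in>A. B f' (f i))"
    by (induction A rule: infinite_finite_induct) (simp_all add: is_hall_formD[OF assms])
qed

text \<open>Expand \<open>g\<close> in the monomial basis and apply duality termwise. Later pairings
  are computed through this formula.\<close>

lemma is_hall_form_h_part: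
  assumes "is_hall_form B" "\<mu> \<turnstile> a"
  shows "B (h_part \<mu>) g = mcoeff g (mset \<mu>)"
proof -
  obtain d where d: "\<And>M. coeff g M \<noteq> 0 \<Longrightarrow> size M \<le> d" using ex_degree_bound by blast
  have \<mu>: "\<mu> \<in> partitions_le a" using assms(2) by (auto simp: partitions_le_def)
  have "B (h_part \<mu>) (m_part \<nu>) = mcoeff (m_part \<nu>) (mset \<mu>)" if \<nu>: "\<nu> \<in> partitions_le d" for \<nu>
  proof -
    obtain b where "\<nu> \<turnstile> b" using \<nu> by (auto simp: partitions_le_def)
    then show ?thesis
      using is_hall_formD(5)[OF assms, of \<nu> b] mcoeff_m_part[OF \<nu> \<mu>]
      by (cases "\<mu> = \<nu>") simp_all
  qed
  then have "B (h_part \<mu>) (\<Sum>\<nu>\<in>partitions_le d. smult (mcoeff g (mset \<nu>)) (m_part \<nu>)) =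
      mcoeff (\<Sum>\<nu>\<in>partitions_le d. smult (mcoeff g (mset \<nu>)) (m_part \<nu>)) (mset \<mu>)"
    by (simp add: is_hall_form_sum[OF assms(1)] is_hall_formD[OF assms(1)] mcoeff_sum mcoeff_smult)
  then show ?thesis by (simp flip: symfun_expand_m_part[of g d, OF d])
qed

text \<open>Both forms agree on the \<open>h_part\<close> in the first argument, and these
  span.\<close>

lemma is_hall_form_unique:
  assumes "is_hall_form B" "is_hall_form (B' :: 'a::field_char_0 symfun \<Rightarrow> 'a symfun \<Rightarrow> 'a)"
  shows "B = B'"
proof (intro ext)
  fix f g :: "'a symfun"
  show "B f g = B' f g"
    using span_h_part[of f]
  proof (rule symfun.span_induct)
    show "symfun.subspace {f. B f g = B' f g}"
      using is_hall_formD(2)[OF assms(1), of 0 0 g] is_hall_formD(2)[OF assms(2), of 0 0 g]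
      by (intro symfun.subspaceI) (auto simp: is_hall_formD[OF assms(1)] is_hall_formD[OF assms(2)])
  qed (use assms in \<open>auto simp: is_hall_form_h_part partitions_le_def\<close>)
qed

lemma ex_hall_form: "\<exists>B :: 'a::field_char_0 symfun \<Rightarrow> 'a symfun \<Rightarrow> 'a. is_hall_form B"
proof -
  interpret F: vector_space "(*) :: 'a \<Rightarrow> 'a \<Rightarrow> 'a"
    by unfold_locales (simp_all add: algebra_simps)
  interpret P: vector_space_pair "smult :: 'a \<Rightarrow> _" "(*) :: 'a \<Rightarrow> 'a \<Rightarrow> 'a"
    by unfold_locales
  let ?H = "h_part ` partitions :: 'a symfun set"
  \<comment> \<open>The form must send the basis element indexed by \<mu> to the coefficient of
    \<open>m_part \<mu>\<close> in \<open>g\<close>; injectivity of \<open>h_part\<close> on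
    partitions recovers \<mu> from that element. \<open>B\<close> is the linear extension.\<close>
  define c where "c g h = mcoeff g (mset (inv_into partitions h_part h))" for g h :: "'a symfun"
  define B where "B f g = P.construct ?H (c g) f" for f g
  note ind = independent_h_part[where 'a = 'a]
  have "is_hall_form B"
    unfolding is_hall_form_def
  proof (intro conjI allI impI)
    fix g
    show "Vector_Spaces.linear smult (*) (\<lambda>f. B f g)"
      unfolding B_def by (rule P.linear_construct[OF ind])
  next
    fix f
    have "c (g + g') = (\<lambda>h. c g h + c g' h)" "c (smult a g) = (\<lambda>h. a * c g h)" for g g' a
      by (simp_all add: c_def fun_eq_iff mcoeff_add mcoeff_smult)
    then show "Vector_Spaces.linear smult (*) (\<lambda>g. B f g)"
      by (simp add: Vector_Spaces.linear_iff B_def P.construct_add[OF ind] P.construct_scale[OF ind]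
          symfun.vector_space_axioms F.vector_space_axioms)
  next
    fix \<nu> \<mu> a b assume "\<nu> \<turnstile> a" "\<mu> \<turnstile> b"
    then have *: "\<nu> \<in> partitions_le a" "\<mu> \<in> partitions_le b" by (auto simp: partitions_le_def)
    then have "B (h_part \<nu>) (m_part \<mu>) = c (m_part \<mu>) (h_part \<nu>)"
      unfolding B_def by (intro P.construct_basis[OF ind] imageI) auto
    also have "inv_into partitions h_part (h_part \<nu> :: 'a symfun) = \<nu>"
      using * by (intro inv_into_f_f inj_on_h_part) auto
    then have "c (m_part \<mu>) (h_part \<nu>) = mcoeff (m_part \<mu>) (mset \<nu>)" by (simp add: c_def)
    also have "\<dots> = (if \<nu> = \<mu> then 1 else 0)"
      using mcoeff_m_part[OF *(2,1)] by auto
    finally show "B (h_part \<nu>) (m_part \<mu>) = (if \<nu> = \<mu> then 1 else 0)" .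
  qed
  then show ?thesis by blast
qed

lemma is_hall_form_hall: "is_hall_form (hall :: 'a::field_char_0 symfun \<Rightarrow> 'a symfun \<Rightarrow> 'a)"
  unfolding hall_def using ex_hall_form is_hall_form_unique by (metis theI)

section \<open>Specialisation at ones\<close>

definition homog :: "nat \<Rightarrow> 'a::comm_ring_1 symfun \<Rightarrow> bool" where
  "homog d f \<longleftrightarrow> (\<forall>M. coeff f M \<noteq> 0 \<longrightarrow> size M = d)"

text \<open>The degree is an argument because only the part of degree \<open>d\<close> is evaluated;
  on homogeneous functions of that degree this is the full specialisation.\<close>

definition at_ones :: "nat \<Rightarrow> nat \<Rightarrow> 'a::comm_ring_1 symfun \<Rightarrow> 'a" where
  "at_ones N d f = (\<Sum>M\<in>msets N d. coeff f M)"

lemma homog_1: "homog 0 1"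
  by (simp add: homog_def coeff_simps)

lemma homog_h_sym: "homog n (h_sym n)"
  by (simp add: homog_def coeff_simps)

lemma homog_smult: "homog d f \<Longrightarrow> homog d (smult c f)"
  unfolding homog_def smult.rep_eq by (metis mult_zero_right)

lemma homog_sum: "(\<And>i. i \<in> A \<Longrightarrow> homog d (f i)) \<Longrightarrow> homog d (\<Sum>i\<in>A. f i)"
  unfolding homog_def coeff_sum by (meson sum.not_neutral_contains_not_neutral)

lemma homog_mult:
  assumes "homog d f" "homog e g"
  shows "homog (d + e) (f * g)"
  unfolding homog_def
proof (intro allI impI)
  fix M assume "coeff (f * g) M \<noteq> 0"
  then obtain A where A: "A \<subseteq># M" "coeff f A * coeff g (M - A) \<noteq> 0"
    unfolding times_symfun.rep_eq by (auto elim: sum.not_neutral_contains_not_neutral)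
  then have "coeff f A \<noteq> 0" "coeff g (M - A) \<noteq> 0" by auto
  then have "size A = d" "size (M - A) = e" using assms by (auto simp: homog_def)
  then show "size M = d + e"
    using A(1) by (metis size_union subset_mset.add_diff_inverse)
qed

lemma at_ones_1: "at_ones N 0 1 = 1"
proof -
  have "msets N 0 = {{#}}" by (auto simp: msets_def)
  then show ?thesis by (simp add: at_ones_def coeff_simps)
qed

lemma at_ones_smult: "at_ones N d (smult c f) = c * at_ones N d f"
  by (simp add: at_ones_def coeff_simps sum_distrib_left)

lemma at_ones_sum: "at_ones N d (\<Sum>i\<in>A. f i) = (\<Sum>i\<in>A. at_ones N d (f i))"
  unfolding at_ones_def coeff_sum by (rule sum.swap)

lemma at_ones_mult:
  assumes "homog d f" "homog e g"
  shows "at_ones N (d + e) (f * g) = at_ones N d f * at_ones N e g"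
proof -
  have "at_ones N (d + e) (f * g) =
      (\<Sum>(M, A) \<in> (SIGMA M:msets N (d + e). {A. A \<subseteq># M}). coeff f A * coeff g (M - A))"
    by (simp add: at_ones_def coeff_simps sum.Sigma finite_submultisets)
  \<comment> \<open>Vanishing terms are set aside on both sides. For the others homogeneity forces
    \<open>A\<close> and \<open>M - A\<close> to have degrees \<open>d\<close> and \<open>e\<close>,
    so the two index sets match.\<close>
  also have "\<dots> = (\<Sum>(A, B) \<in> msets N d \<times> msets N e. coeff f A * coeff g B)"
  proof (rule sum.reindex_bij_witness_not_neutral
      [where i = "\<lambda>(A, B). (A + B, A)" and j = "\<lambda>(M, A). (A, M - A)"
        and S' = "{(M, A). M \<in> msets N (d + e) \<and> A \<subseteq># M \<and> coeff f A * coeff g (M - A) = 0}"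
        and T' = "{(A, B). A \<in> msets N d \<and> B \<in> msets N e \<and> coeff f A * coeff g B = 0}"])
    show "finite {(M, A). M \<in> msets N (d + e) \<and> A \<subseteq># M \<and> coeff f A * coeff g (M - A) = 0}"
      by (rule finite_subset[of _ "SIGMA M:msets N (d + e). {A. A \<subseteq># M}"])
        (auto simp: finite_submultisets)
    show "finite {(A, B). A \<in> msets N d \<and> B \<in> msets N e \<and> coeff f A * coeff g B = 0}"
      by (rule finite_subset[of _ "msets N d \<times> msets N e"]) auto
    fix a assume a: "a \<in> (SIGMA M:msets N (d + e). {A. A \<subseteq># M}) -
      {(M, A). M \<in> msets N (d + e) \<and> A \<subseteq># M \<and> coeff f A * coeff g (M - A) = 0}"
    obtain M A where MA: "a = (M, A)" by (cases a)
    have M: "M \<in> msets N (d + e)" "A \<subseteq># M" "coeff f A * coeff g (M - A) \<noteq> 0"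
      using a MA by auto
    then have "coeff f A \<noteq> 0" "coeff g (M - A) \<noteq> 0" by auto
    then have "size A = d" "size (M - A) = e" using assms by (auto simp: homog_def)
    moreover have "set_mset A \<subseteq> {..<N}" "set_mset (M - A) \<subseteq> {..<N}"
      using M(1) set_mset_mono[OF M(2)] by (auto simp: msets_def dest: in_diffD)
    ultimately show "(case a of (M, A) \<Rightarrow> (A, M - A)) \<in> msets N d \<times> msets N e -
        {(A, B). A \<in> msets N d \<and> B \<in> msets N e \<and> coeff f A * coeff g B = 0}"
      using M(3) by (simp add: MA msets_def)
    show "(case case a of (M, A) \<Rightarrow> (A, M - A) of (A, B) \<Rightarrow> (A + B, A)) = a"
      using M(2) by (simp add: MA)
  qed (use assms in \<open>auto simp: msets_def\<close>)
  also have "\<dots> = at_ones N d f * at_ones N e g"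
    by (simp add: at_ones_def sum_product sum.cartesian_product)
  finally show ?thesis .
qed

lemma at_ones_h_sym:
  "at_ones N n (h_sym n :: 'a::field_char_0 symfun) = (- 1) ^ n * ((- of_nat N) gchoose n)"
proof -
  have "at_ones N n (h_sym n :: 'a symfun) = (\<Sum>M\<in>msets N n. 1)"
    unfolding at_ones_def by (rule sum.cong) (auto simp: coeff_simps msets_def)
  then show ?thesis by (simp add: card_msets)
qed

lemma
  shows homog_h_part: "homog (sum_list \<mu>) (h_part \<mu> :: 'a::field_char_0 symfun)"
    and at_ones_h_part: "at_ones N (sum_list \<mu>) (h_part \<mu> :: 'a symfun) =
      (\<Prod>p\<in>#mset \<mu>. (- 1) ^ p * ((- of_nat N) gchoose p))"
proof (induction \<mu>)
  case (Cons p \<mu>)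
  case 1
  show ?case using homog_mult[OF homog_h_sym Cons(1)] by (simp add: h_part_def)
  case 2
  show ?case
    using at_ones_mult[OF homog_h_sym[of p] Cons(1), of N] Cons(2) by (simp add: h_part_def at_ones_h_sym)
qed (simp_all add: h_part_def homog_1 at_ones_1)

section \<open>The values of \<open>F_park\<close> at ones\<close>

text \<open>The left-hand side is a rising factorial over \<open>fact m\<close>. Splitting off its
  first factor \<open>a\<close> gives the shape that \<open>sum_partitions_eq_polyfun\<close> asks
  for.\<close>

lemma negated_gbinomial:
  fixes a :: "'a::field_char_0"
  assumes "m > 0"
  shows "(- 1) ^ m * ((- a) gchoose m) = a * ((\<Prod>j = 1..<m. a + of_nat j) / fact m)"
proof -
  have "(- 1) ^ m * ((- a) gchoose m) = pochhammer a m / fact m"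
    by (simp add: gbinomial_pochhammer flip: power_mult_distrib mult.assoc)
  also have "pochhammer a m = a * (\<Prod>j = 1..<m. a + of_nat j)"
    using assms by (simp add: pochhammer_prod prod.atLeast_Suc_lessThan)
  finally show ?thesis by simp
qed

lemma homog_F_park: "homog m (F_park r k m)"
proof (cases "m = 0")
  case False
  have "homog m (h_part \<mu> :: 'a symfun)" if "\<mu> \<turnstile> m" for \<mu>
    using homog_h_part[of \<mu>] that by (simp add: partition_of_def)
  with False show ?thesis
    unfolding F_park_def by (auto intro!: homog_smult homog_sum)
qed (simp add: F_park_def homog_1)

text \<open>Summing the values of the \<open>h_part\<close> at \<open>N\<close> ones over the
  monomials of degree \<open>m\<close> in \<open>Y\<close> variables gives the coefficient of t^m in
  (1 - t)^(-N Y). This is a polynomial in \<open>Y\<close>, and r m + k may be substituted for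
  \<open>Y\<close>. The factor \<open>of_nat N\<close> stays in front for use in
  \<open>hall_F_park_left\<close>.\<close>

lemma at_ones_F_park:
  assumes "m > 0"
  shows "at_ones N m (F_park r k m :: 'a::field_char_0 symfun) =
    of_nat N * (k / fact m * (\<Prod>j = 1..<m. of_nat N * (of_nat (r * m) + k) + of_nat j))"
proof -
  define c where "c \<nu> = (\<Prod>p\<in>#\<nu>. (- 1) ^ p * ((- of_nat N :: 'a) gchoose p))" for \<nu>
  \<comment> \<open>Here \<open>x * Q x\<close> is the negative binomial expression with top entry -
    N x.\<close>
  define Q where "Q x = of_nat N * ((\<Prod>j = 1..<m. of_nat N * x + of_nat j) / fact m)" for x :: 'a
  have "at_ones N m (h_part \<mu>) = c (mset \<mu>)" if "\<mu> \<turnstile> m" for \<mu>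
    using at_ones_h_part[of N \<mu>, where 'a = 'a] that by (simp add: c_def partition_of_def)
  then have "at_ones N m (F_park r k m) = k * (\<Sum>\<mu> | \<mu> \<turnstile> m.
      (\<Prod>j = 1..<length \<mu>. of_nat (r * m) + k - of_nat j) /
        (\<Prod>i = 1..m. fact (count_list \<mu> i)) * c (mset \<mu>))"
    using assms unfolding F_park_def by (simp add: at_ones_smult at_ones_sum)
  also have "\<dots> = k * Q (of_nat (r * m) + k)"
  proof (subst sum_partitions_eq_polyfun[where c = c and Q = Q, OF assms])
    show "polyfun Q" unfolding Q_def by (intro polyfun_intros)
    show "(\<Sum>M\<in>msets Y m. c (exponents M)) = of_nat Y * Q (of_nat Y)" for Y
      using negated_gbinomial[OF assms, of "of_nat N * of_nat Y :: 'a"]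
      unfolding c_def sum_msets_prod_exponents by (simp add: Q_def)
  qed simp
  finally show ?thesis by (simp add: Q_def)
qed

lemma
  assumes "finite A" "\<And>i. i \<in> A \<Longrightarrow> homog (d i) (f i)"
  shows homog_prod: "homog (\<Sum>i\<in>A. d i) (\<Prod>i\<in>A. f i)"
    and at_ones_prod: "at_ones N (\<Sum>i\<in>A. d i) (\<Prod>i\<in>A. f i) = (\<Prod>i\<in>A. at_ones N (d i) (f i))"
  using assms by (induction A) (simp_all add: homog_1 at_ones_1 homog_mult at_ones_mult)

section \<open>Pairing with \<open>F_park\<close>\<close>

text \<open>Pairing with \<open>h_part \<mu>\<close> extracts \<open>mcoeff g (mset \<mu>)\<close>,
  and the sum of these coefficients over the monomials in \<open>N\<close> variables is
  \<open>at_ones N n g\<close>. So the pairing is the specialisation, divided by \<open>N\<close>,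
  with \<open>N\<close> replaced by r n + k.\<close>

lemma hall_F_park_left:
  fixes g :: "'a::field_char_0 symfun"
  assumes "n > 0" "polyfun Q" "\<And>N. N > 0 \<Longrightarrow> at_ones N n g = of_nat N * Q (of_nat N)"
  shows "hall (F_park r k n) g = k * Q (of_nat (r * n) + k)"
proof -
  have "hall (F_park r k n) g = k * (\<Sum>\<mu> | \<mu> \<turnstile> n.
      (\<Prod>j = 1..<length \<mu>. of_nat (r * n) + k - of_nat j) /
        (\<Prod>i = 1..n. fact (count_list \<mu> i)) * mcoeff g (mset \<mu>))"
    using assms(1) unfolding F_park_def
    by (simp add: is_hall_formD[OF is_hall_form_hall] is_hall_form_sum[OF is_hall_form_hall]
        is_hall_form_h_part[OF is_hall_form_hall])
  also have "\<dots> = k * Q (of_nat (r * n) + k)"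
    by (subst sum_partitions_eq_polyfun[where c = "mcoeff g" and Q = Q])
      (use assms in \<open>auto simp: at_ones_def\<close>)
  finally show ?thesis .
qed

lemma hall_1_1: "hall 1 (1 :: 'a::field_char_0 symfun) = 1"
proof -
  have "[] \<turnstile> 0" by (simp add: partition_of_def)
  then show ?thesis
    using is_hall_form_h_part[OF is_hall_form_hall, of "[]" 0 "1 :: 'a symfun"]
      mcoeff_exponents[of "1 :: 'a symfun" "{#}"]
    by (simp add: h_part_def coeff_simps)
qed

lemma prod_const_mult:
  fixes c :: "'a::comm_monoid_mult"
  assumes "l > 0"
  shows "(\<Prod>i<l. c * f i) = c * (c ^ (l - 1) * (\<Prod>i<l. f i))"
  using assms by (cases l) (simp_all only: prod.distrib prod_constant card_lessThan power_Suc
      diff_Suc_1 mult.assoc)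

text \<open>The case n = 0 stands apart: \<open>length lam - 1\<close> is truncated to 0 there, so
  the general formula would give \<open>k\<close> instead of 1.\<close>

lemma hall_F_park_prod:
  fixes k :: "'a::field_char_0"
  assumes "lam \<turnstile> n"
  shows "hall (F_park r k n) (\<Prod>i<length lam. F_park (rs i) (ks i) (lam ! i)) =
       (if n = 0 then 1 else
        k * (of_nat (r * n) + k) ^ (length lam - 1) *
        (\<Prod>i<length lam. ks i / fact (lam ! i) *
           (\<Prod>j = 1..<lam ! i.
              (of_nat (r * n) + k) * (of_nat (rs i * lam ! i) + ks i) + of_nat j)))"
proof (cases "n = 0")
  case True
  then have "lam = []" using assms by (cases lam) (auto simp: partition_of_def)
  with True show ?thesis by (simp add: F_park_def hall_1_1)
next
  case False
  have pos: "lam ! i > 0" if "i < length lam" for i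
    using assms that by (metis gr0I nth_mem partition_of_def)
  have n: "(\<Sum>i<length lam. lam ! i) = n"
    using assms by (simp add: partition_of_def sum_list_sum_nth atLeast0LessThan)
  with False have len: "length lam > 0" by (cases lam) auto
  \<comment> \<open>Each factor of the product contributes one \<open>N\<close> at \<open>N\<close>
    ones. One of them is the prefactor required by \<open>hall_F_park_left\<close>, and the others
    form this power.\<close>
  define Q where "Q x = x ^ (length lam - 1) * (\<Prod>i<length lam. ks i / fact (lam ! i) *
      (\<Prod>j = 1..<lam ! i. x * (of_nat (rs i * lam ! i) + ks i) + of_nat j))" for x
  have "hall (F_park r k n) (\<Prod>i<length lam. F_park (rs i) (ks i) (lam ! i)) =
      k * Q (of_nat (r * n) + k)"
  proof (rule hall_F_park_left)
    show "n > 0" using False by simp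
    show "polyfun Q" unfolding Q_def by (intro polyfun_intros)
    fix N :: nat
    have "at_ones N n (\<Prod>i<length lam. F_park (rs i) (ks i) (lam ! i)) =
        (\<Prod>i<length lam. at_ones N (lam ! i) (F_park (rs i) (ks i) (lam ! i)))"
      unfolding n[symmetric] by (rule at_ones_prod) (simp_all add: homog_F_park)
    also have "\<dots> = (\<Prod>i<length lam. of_nat N * (ks i / fact (lam ! i) *
        (\<Prod>j = 1..<lam ! i. of_nat N * (of_nat (rs i * lam ! i) + ks i) + of_nat j)))"
      by (rule prod.cong) (simp_all add: at_ones_F_park pos)
    also have "\<dots> = of_nat N * Q (of_nat N)"
      unfolding prod_const_mult[OF len] Q_def ..
    finally show "at_ones N n (\<Prod>i<length lam. F_park (rs i) (ks i) (lam ! i)) =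
        of_nat N * Q (of_nat N)" .
  qed
  with False show ?thesis by (simp add: Q_def)
qed

lemma gbinomial_shift:
  fixes z :: "'a::field_char_0"
  assumes "m > 0"
  shows "(z + of_nat m - 1) gchoose m = z * ((\<Prod>j = 1..<m. z + of_nat j) / fact m)"
  using negated_gbinomial[OF assms, of z] by
    (simp add: gbinomial_minus flip: power_mult_distrib mult.assoc)

text \<open>An integer \<open>k\<close> or \<open>ks i\<close> can make a denominator vanish. The
  quotient form is therefore conditional, and the second conjunct is a division-free form that
  covers the remaining values.\<close>

theorem theorem5p2:
  fixes n r :: nat and lam :: "nat list" and rs :: "nat \<Rightarrow> nat"
    and k :: ratfun and ks :: "nat \<Rightarrow> ratfun"
  assumes "lam \<turnstile> n"
    and "r > 0" and "\<forall>i. rs i > 0"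
    and "int_or_indet k" and "\<forall>i. int_or_indet (ks i)"
  shows
    "(of_nat (r * n) + k \<noteq> 0 \<and> (\<forall>i<length lam. of_nat (rs i * lam ! i) + ks i \<noteq> 0) \<longrightarrow>
        hall (F_park r k n) (\<Prod>i<length lam. F_park (rs i) (ks i) (lam ! i)) =
        k / (of_nat (r * n) + k) *
        (\<Prod>i<length lam. ks i / (of_nat (rs i * lam ! i) + ks i) *
           (((of_nat (r * n) + k) * (of_nat (rs i * lam ! i) + ks i) + of_nat (lam ! i) - 1)
              gchoose (lam ! i))))
     \<and>
     hall (F_park r k n) (\<Prod>i<length lam. F_park (rs i) (ks i) (lam ! i)) =
       (if n = 0 then 1 else
        k * (of_nat (r * n) + k) ^ (length lam - 1) *
        (\<Prod>i<length lam. ks i / fact (lam ! i) *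
           (\<Prod>j = 1..<lam ! i.
              (of_nat (r * n) + k) * (of_nat (rs i * lam ! i) + ks i) + of_nat j)))"
proof (intro conjI impI)
  define x where "x = of_nat (r * n) + k"
  define y where "y i = of_nat (rs i * lam ! i) + ks i" for i
  assume "of_nat (r * n) + k \<noteq> 0 \<and> (\<forall>i<length lam. of_nat (rs i * lam ! i) + ks i \<noteq> 0)"
  then have x: "x \<noteq> 0" and y: "\<And>i. i < length lam \<Longrightarrow> y i \<noteq> 0" by (auto simp: x_def y_def)
  have pos: "lam ! i > 0" if "i < length lam" for i
    using assms(1) that by (metis gr0I nth_mem partition_of_def)
  \<comment> \<open>The power of \<open>x\<close> is distributed over the factors, one
    \<open>x\<close> each; the surplus one is compensated by \<open>k / x\<close>. For n = 0 there
    are no factors and \<open>x\<close> equals \<open>k\<close>.\<close>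
  have "hall (F_park r k n) (\<Prod>i<length lam. F_park (rs i) (ks i) (lam ! i)) =
      k / x * (\<Prod>i<length lam. x * (ks i / fact (lam ! i) *
        (\<Prod>j = 1..<lam ! i. x * y i + of_nat j)))"
  proof (cases "n = 0")
    case True
    then have "lam = []" using assms(1) by (cases lam) (auto simp: partition_of_def)
    with True x show ?thesis by (simp add: F_park_def hall_1_1 x_def)
  next
    case False
    then have len: "length lam > 0" using assms(1) by (cases lam) (auto simp: partition_of_def)
    show ?thesis
      unfolding hall_F_park_prod[OF assms(1)] prod_const_mult[OF len]
      by (simp only: False if_False flip: x_def y_def) (use x in simp)
  qed
  \<comment> \<open>The binomial contains the factor \<open>x * y i\<close>; its \<open>y i\<close>
    cancels the denominator and its \<open>x\<close> is the one just distributed.\<close>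
  also have "(\<Prod>i<length lam. x * (ks i / fact (lam ! i) * (\<Prod>j = 1..<lam ! i. x * y i + of_nat j))) =
      (\<Prod>i<length lam. ks i / y i * ((x * y i + of_nat (lam ! i) - 1) gchoose (lam ! i)))"
    by (rule prod.cong) (simp_all add: gbinomial_shift pos y)
  finally show "hall (F_park r k n) (\<Prod>i<length lam. F_park (rs i) (ks i) (lam ! i)) =
        k / (of_nat (r * n) + k) *
        (\<Prod>i<length lam. ks i / (of_nat (rs i * lam ! i) + ks i) *
           (((of_nat (r * n) + k) * (of_nat (rs i * lam ! i) + ks i) + of_nat (lam ! i) - 1)
              gchoose (lam ! i)))"
    by (simp only: x_def y_def)
qed (rule hall_F_park_prod[OF assms(1)])

end
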